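(* Let $\mathcal H\subset\mathbb R^2$ be a nonempty bounded open set with $B_2(0)\subset\mathcal H\subset B_{\mathcal R}(0)$ for some $\mathcal R\in(2,\infty)$. Let $J\in C^2_c(\mathbb R^2)$ be radially symmetric with $J(x)>0$ if $|x|<d$, $J(x)=0$ if $|x|\ge d$ (for some $d>0$), and $\int_{\mathbb R^2}J=1$. Let $u_0\ge0$ with $u_0=0$ in $\mathcal H$ and $u_0\in L^\infty(\mathbb R^2)\cap L^1(\mathbb R^2,\log|x|\,dx)$. Let $u$ be the solution of the nonlocal exterior problem with hole $\mathcal H$ and initial datum $u_0$, and let $M_\phi^*=\int_{\mathbb R^2}u_0\phi$, where $\phi$ is the stationary solution with logarithmic behavior at infinity. Then $$\lim_{t\to\infty}\int_{\mathbb R^2}u(x,t)\log|x|\,dx=M_\phi^*.$$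
   Context: $L$ is the operator $Lg:=J*g-g$. The solution $u\in C([0,\infty);L^1(\mathbb R^2))$ is the unique solution of: $\partial_tu=Lu$ in $(\mathbb R^2\setminus\mathcal H)\times(0,\infty)$, $u=0$ in $\mathcal H\times(0,\infty)$, $u(\cdot,0)=u_0$ in $\mathbb R^2$. $\phi$ is the unique (locally bounded measurable) function with $L\phi=0$ in $\mathbb R^2\setminus\mathcal H$, $\phi=0$ in $\mathcal H$, and $\phi(x)-\log|x|\in L^\infty(\mathbb R^2\setminus\mathcal H)$. *)

theory Defs
  imports "HOL-Analysis.Analysis"
begin

(* Elements of L^1 and L^infinity are represented by Borel functions; every condition
   on them below is invariant under changes on Lebesgue-null sets. *)

type_synonym plane = "real ^ 2"

definition C2 :: "('a::real_normed_vector \<Rightarrow> real) \<Rightarrow> bool" where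
  "C2 f \<longleftrightarrow> (\<exists>(f' :: 'a \<Rightarrow> 'a \<Rightarrow>\<^sub>L real) (f'' :: 'a \<Rightarrow> 'a \<Rightarrow>\<^sub>L 'a \<Rightarrow>\<^sub>L real).
     (\<forall>x. (f has_derivative blinfun_apply (f' x)) (at x)) \<and>
     (\<forall>x. (f' has_derivative blinfun_apply (f'' x)) (at x)) \<and>
     continuous_on UNIV f'')"

definition compactly_supported :: "('a::topological_space \<Rightarrow> real) \<Rightarrow> bool" where
  "compactly_supported f \<longleftrightarrow> compact (closure {x. f x \<noteq> 0})"

definition radially_symmetric :: "('a::real_normed_vector \<Rightarrow> real) \<Rightarrow> bool" where
  "radially_symmetric f \<longleftrightarrow> (\<forall>x y. norm x = norm y \<longrightarrow> f x = f y)"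

definition Linfty_on :: "plane set \<Rightarrow> (plane \<Rightarrow> real) \<Rightarrow> bool" where
  "Linfty_on S f \<longleftrightarrow> set_borel_measurable lborel S f \<and> (\<exists>C. AE x\<in>S in lborel. \<bar>f x\<bar> \<le> C)"

definition convolve :: "(plane \<Rightarrow> real) \<Rightarrow> (plane \<Rightarrow> real) \<Rightarrow> plane \<Rightarrow> real" where
  "convolve f g x = (LINT y|lborel. f (x - y) * g y)"

definition nonlocal_op :: "(plane \<Rightarrow> real) \<Rightarrow> (plane \<Rightarrow> real) \<Rightarrow> plane \<Rightarrow> real" where
  "nonlocal_op J g x = convolve J g x - g x"

definition continuous_into_L1 :: "(real \<Rightarrow> plane \<Rightarrow> real) \<Rightarrow> bool" where
  "continuous_into_L1 u \<longleftrightarrow>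
     (\<forall>t\<ge>0. integrable lborel (u t)) \<and>
     (\<forall>t\<ge>0. ((\<lambda>s. LINT x|lborel. \<bar>u s x - u t x\<bar>) \<longlongrightarrow> 0) (at t within {0..}))"

(* The time derivative is that of the L^1-valued curve t \<mapsto> u t, restricted to the
   complement of the hole. Values of u at negative times are irrelevant. *)
definition exterior_solution ::
  "(plane \<Rightarrow> real) \<Rightarrow> plane set \<Rightarrow> (plane \<Rightarrow> real) \<Rightarrow> (real \<Rightarrow> plane \<Rightarrow> real) \<Rightarrow> bool" where
  "exterior_solution J H u0 u \<longleftrightarrow>
     continuous_into_L1 u \<and>
     (\<forall>t>0. ((\<lambda>s. LINT x:(- H)|lborel. \<bar>(u s x - u t x) / (s - t) - nonlocal_op J (u t) x\<bar>)
               \<longlongrightarrow> 0) (at t)) \<and>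
     (\<forall>t>0. AE x\<in>H in lborel. u t x = 0) \<and>
     (AE x in lborel. u 0 x = u0 x)"

definition log_stationary :: "(plane \<Rightarrow> real) \<Rightarrow> plane set \<Rightarrow> (plane \<Rightarrow> real) \<Rightarrow> bool" where
  "log_stationary J H \<phi> \<longleftrightarrow>
     \<phi> \<in> borel_measurable lborel \<and>
     (\<forall>K. compact K \<longrightarrow> Linfty_on K \<phi>) \<and>
     (AE x\<in>- H in lborel. nonlocal_op J \<phi> x = 0) \<and>
     (AE x\<in>H in lborel. \<phi> x = 0) \<and>
     Linfty_on (- H) (\<lambda>x. \<phi> x - ln (norm x))"

end

theory Submission
  imports Defs
begin

text \<open>
  Write $A$ for the complement of the hole, $K\psi = J * (1_A\psi)$ and
  $\langle u(t),\psi\rangle = \int u(t)\,\psi$. By symmetry of $J$,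
  $\frac{d}{dt}\langle u,\psi\rangle = \langle u, K\psi\rangle - \langle u,\psi\rangle$
  for every bounded $\psi$, and everything is read off from suitable choices of $\psi$.
  Truncations of $\log|x|$ bound the logarithmic moment, and cut-offs of $\phi$ show that
  $\langle u(t),\phi\rangle$ is conserved. As $\phi - \log|x|$ is bounded on $A$, it remains to see
  that the mass of $u(t)$ tends to $0$. Conservation of $\langle u,\phi\rangle$ makes $u(t)$ tight,
  with tail mass at most $C / \log\rho$ outside radius $\rho$. On the other hand the total time spent
  in any ball is finite: this holds for the function $1 - K1$, whose time integral is the mass lost
  to the hole, it is inherited by $K\psi$ from $\psi$, and hence it spreads from the hole to every
  ball in finitely many steps. So the mass is small at some time, and it is nonincreasing.
\<close>

section \<open>Bounded test functions and the jump kernel\<close>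

lemma lborel_reflect:
  fixes x :: "'a::euclidean_space"
  shows "distr lborel borel (\<lambda>y. x - y) = lborel"
  using lborel_affine[of "-1" x] by (simp add: density_1)

lemma integrable_lborel_reflect:
  fixes f :: "'a::euclidean_space \<Rightarrow> real"
  assumes "integrable lborel f"
  shows "integrable lborel (\<lambda>y. f (x - y))"
proof -
  have "integrable (distr lborel borel (\<lambda>y. x - y)) f"
    using assms by (simp add: lborel_reflect)
  then show ?thesis
    using assms by (subst (asm) integrable_distr_eq) auto
qed

lemma integral_lborel_reflect:
  fixes f :: "'a::euclidean_space \<Rightarrow> real"
  assumes "f \<in> borel_measurable borel"
  shows "(LINT y|lborel. f (x - y)) = (LINT y|lborel. f y)"
proof -
  have "(LINT y|distr lborel borel (\<lambda>y. x - y). f y) = (LINT y|lborel. f (x - y))"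
    using assms by (intro integral_distr) auto
  then show ?thesis by (simp add: lborel_reflect)
qed

text \<open>The bound holds at every point, not only almost everywhere, so that convolutions and
  their iterates can be estimated pointwise.\<close>

definition bounded_test :: "('a::topological_space \<Rightarrow> real) \<Rightarrow> bool" where
  "bounded_test \<psi> \<longleftrightarrow> \<psi> \<in> borel_measurable borel \<and> (\<exists>B. \<forall>x. \<bar>\<psi> x\<bar> \<le> B)"

lemma bounded_testI:
  assumes "\<psi> \<in> borel_measurable borel" and "\<And>x. \<bar>\<psi> x\<bar> \<le> B"
  shows "bounded_test \<psi>"
  using assms by (auto simp: bounded_test_def)

lemma bounded_test_measurable: "bounded_test \<psi> \<Longrightarrow> \<psi> \<in> borel_measurable borel"
  by (simp add: bounded_test_def)

lemma bounded_test_bound: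
  assumes "bounded_test \<psi>"
  obtains B where "0 \<le> B" and "\<And>x. \<bar>\<psi> x\<bar> \<le> B"
proof -
  from assms obtain B where "\<And>x. \<bar>\<psi> x\<bar> \<le> B" by (auto simp: bounded_test_def)
  moreover from this[of undefined] have "0 \<le> B" by linarith
  ultimately show ?thesis using that by blast
qed

lemma bounded_test_const: "bounded_test (\<lambda>x. c)"
  by (rule bounded_testI[where B="\<bar>c\<bar>"]) auto

lemma bounded_test_indicator: "S \<in> sets borel \<Longrightarrow> bounded_test (indicator S)"
  by (rule bounded_testI[where B=1]) (auto simp: indicator_def)

lemma bounded_test_add:
  assumes "bounded_test f" "bounded_test g"
  shows "bounded_test (\<lambda>x. f x + g x)"
proof -
  obtain B C where "\<And>x. \<bar>f x\<bar> \<le> B" "\<And>x. \<bar>g x\<bar> \<le> C"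
    using assms by (meson bounded_test_bound)
  then show ?thesis
    using assms by (intro bounded_testI[where B="B + C"])
      (auto simp: bounded_test_def intro!: order_trans[OF abs_triangle_ineq] add_mono)
qed

lemma bounded_test_mult:
  assumes "bounded_test f" "bounded_test g"
  shows "bounded_test (\<lambda>x. f x * g x)"
proof -
  obtain B where B: "0 \<le> B" "\<And>x. \<bar>f x\<bar> \<le> B"
    using bounded_test_bound[OF assms(1)] by metis
  obtain C where "\<And>x. \<bar>g x\<bar> \<le> C"
    using bounded_test_bound[OF assms(2)] by metis
  with B show ?thesis
    using assms by (intro bounded_testI[where B="B * C"])
      (auto simp: bounded_test_def abs_mult intro!: mult_mono)
qed

lemma bounded_test_sum:
  assumes "\<And>i. i \<in> I \<Longrightarrow> bounded_test (f i)"
  shows "bounded_test (\<lambda>x. \<Sum>i\<in>I. f i x)"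
  using assms by (induction I rule: infinite_finite_induct)
    (auto intro: bounded_test_add bounded_test_const)

lemma integrable_mult_bounded_test:
  fixes f :: "'a::euclidean_space \<Rightarrow> real"
  assumes "integrable lborel f" and "bounded_test \<psi>"
  shows "integrable lborel (\<lambda>x. f x * \<psi> x)"
proof -
  obtain B where B: "0 \<le> B" "\<And>x. \<bar>\<psi> x\<bar> \<le> B"
    using bounded_test_bound[OF assms(2)] by metis
  have [measurable]: "\<psi> \<in> borel_measurable borel"
    using assms(2) by (rule bounded_test_measurable)
  have [measurable]: "f \<in> borel_measurable borel" using assms(1) by auto
  show ?thesis
  proof (rule Bochner_Integration.integrable_bound)
    show "integrable lborel (\<lambda>x. \<bar>f x\<bar> * B)" using assms(1) by auto
  qed (use B in \<open>auto simp: abs_mult intro!: mult_left_mono\<close>)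
qed

lemma abs_integral_mult_le:
  fixes f :: "'a::euclidean_space \<Rightarrow> real"
  assumes "integrable lborel f" and "bounded_test \<psi>" and "\<And>x. \<bar>\<psi> x\<bar> \<le> B"
  shows "\<bar>LINT x|lborel. f x * \<psi> x\<bar> \<le> (LINT x|lborel. \<bar>f x\<bar>) * B"
proof -
  have "\<bar>LINT x|lborel. f x * \<psi> x\<bar> \<le> (LINT x|lborel. \<bar>f x * \<psi> x\<bar>)"
    by (rule integral_abs_bound)
  also have "\<dots> \<le> (LINT x|lborel. \<bar>f x\<bar> * B)"
    using integrable_abs[OF integrable_mult_bounded_test[OF assms(1,2)]] assms
    by (intro integral_mono) (auto simp: abs_mult intro!: mult_left_mono)
  finally show ?thesis by simp
qed

text \<open>\<open>J\<close> is the jump density of a symmetric random walk. Evenness makes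
  convolution self-adjoint, and total mass one makes it fix constants.\<close>

locale jump_kernel =
  fixes J :: "plane \<Rightarrow> real"
  assumes J_measurable [measurable]: "J \<in> borel_measurable borel"
    and J_nonneg: "0 \<le> J x"
    and J_even: "J (- x) = J x"
    and J_integral: "(LINT x|lborel. J x) = 1"
begin

text \<open>The Bochner integral of a non-integrable function is \<open>0\<close> by default, so the
  value \<open>1\<close> already forces integrability.\<close>

lemma J_integrable: "integrable lborel J"
  using J_integral not_integrable_integral_eq by fastforce

lemma J_swap: "J (x - y) = J (y - x)"
  using J_even[of "x - y"] by simp

lemma J_shift_integrable: "integrable lborel (\<lambda>y. J (x - y))"
  using J_integrable by (rule integrable_lborel_reflect)

lemma J_shift_integral: "(LINT y|lborel. J (x - y)) = 1"
  by (simp add: integral_lborel_reflect J_integral)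

lemma convolve_const: "convolve J (\<lambda>y. c) x = c"
  using J_shift_integral[of x] by (simp add: convolve_def)

lemma integrable_convolve_test:
  "bounded_test \<psi> \<Longrightarrow> integrable lborel (\<lambda>y. J (x - y) * \<psi> y)"
  using J_shift_integrable by (rule integrable_mult_bounded_test)

lemma convolve_mono:
  assumes "bounded_test f" "bounded_test g" and "\<And>y. f y \<le> g y"
  shows "convolve J f x \<le> convolve J g x"
  unfolding convolve_def using assms J_nonneg
  by (intro integral_mono integrable_convolve_test mult_left_mono) auto

text \<open>Comparison with the constants \<open>B\<close> and \<open>- B\<close>, which convolution
  with \<open>J\<close> leaves unchanged.\<close>

lemma convolve_test:
  assumes "bounded_test \<psi>" and B: "\<And>x. \<bar>\<psi> x\<bar> \<le> B"
  shows "\<bar>convolve J \<psi> x\<bar> \<le> B" and "bounded_test (convolve J \<psi>)"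
proof -
  have *: "\<bar>convolve J \<psi> x\<bar> \<le> B" for x
  proof -
    have "convolve J \<psi> x \<le> convolve J (\<lambda>_. B) x"
      using B by (intro convolve_mono assms bounded_test_const) (simp add: abs_le_iff)
    moreover have "convolve J (\<lambda>_. - B) x \<le> convolve J \<psi> x"
      using B by (intro convolve_mono assms bounded_test_const) (smt (verit))
    ultimately show ?thesis by (simp add: convolve_const abs_le_iff)
  qed
  then show "\<bar>convolve J \<psi> x\<bar> \<le> B" .
  have [measurable]: "\<psi> \<in> borel_measurable borel"
    using assms(1) by (rule bounded_test_measurable)
  have "convolve J \<psi> \<in> borel_measurable borel"
    unfolding convolve_def by measurable
  then show "bounded_test (convolve J \<psi>)"
    using * by (rule bounded_testI)
qed

text \<open>Fubini. Integrating the absolute value in \<open>x\<close> first leaves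
  \<open>\<bar>f y\<bar>\<close> times the bounded function
  \<open>convolve J (\<lambda>x. \<bar>\<psi> x\<bar>) y\<close>, which gives joint integrability.
  The choice \<open>\<psi> = 1\<close> yields the first claim; exchanging the order, with
  \<open>J\<close> even, yields self-adjointness.\<close>

lemma convolve_L1:
  assumes f: "integrable lborel f" and \<psi>: "bounded_test \<psi>"
  shows "integrable lborel (convolve J f)"
    and "(LINT x|lborel. convolve J f x * \<psi> x) = (LINT x|lborel. f x * convolve J \<psi> x)"
proof -
  have [measurable]: "f \<in> borel_measurable borel" using f by auto
  have int: "integrable (lborel \<Otimes>\<^sub>M lborel) (\<lambda>(x, y). J (x - y) * f y * \<psi> x)"
    if \<psi>: "bounded_test \<psi>" for \<psi>
  proof -
    have [measurable]: "\<psi> \<in> borel_measurable borel"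
      using \<psi> by (rule bounded_test_measurable)
    have abs: "bounded_test (\<lambda>x. \<bar>\<psi> x\<bar>)"
      using \<psi> by (auto simp: bounded_test_def)
    have eq: "(LINT x|lborel. \<bar>J (x - y) * f y * \<psi> x\<bar>)
        = \<bar>f y\<bar> * convolve J (\<lambda>x. \<bar>\<psi> x\<bar>) y" for y
      by (simp add: convolve_def abs_mult J_nonneg J_swap[of y] mult_ac
          flip: integral_mult_right_zero)
    obtain B where "\<And>x. \<bar>\<bar>\<psi> x\<bar>\<bar> \<le> B" using bounded_test_bound[OF abs] by metis
    then have "bounded_test (convolve J (\<lambda>x. \<bar>\<psi> x\<bar>))"
      using abs by (intro convolve_test)
    then have "integrable lborel (\<lambda>y. \<bar>f y\<bar> * convolve J (\<lambda>x. \<bar>\<psi> x\<bar>) y)"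
      using f by (intro integrable_mult_bounded_test) auto
    moreover have "integrable lborel (\<lambda>x. J (x - y) * f y * \<psi> x)" for y
      using integrable_mult_right[OF integrable_mult_bounded_test[OF J_shift_integrable \<psi>], of "f y" y]
      by (simp add: J_swap[of y] mult_ac)
    ultimately have "integrable (lborel \<Otimes>\<^sub>M lborel) (\<lambda>(y, x). J (x - y) * f y * \<psi> x)"
      by (intro lborel_pair.Fubini_integrable) (simp_all add: eq)
    then show ?thesis
      by (subst lborel_pair.integrable_product_swap_iff[symmetric]) (simp add: split_beta')
  qed
  show "integrable lborel (convolve J f)"
    using lborel_pair.integrable_fst'[OF int[OF bounded_test_const[of 1]]]
    by (simp add: convolve_def[abs_def])
  have "(LINT x|lborel. convolve J f x * \<psi> x)
      = (LINT x|lborel. LINT y|lborel. J (x - y) * f y * \<psi> x)"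
    by (simp add: convolve_def)
  also have "\<dots> = (LINT y|lborel. LINT x|lborel. J (x - y) * f y * \<psi> x)"
    using lborel_pair.Fubini_integral[OF int[OF \<psi>]] by simp
  also have "\<dots> = (LINT x|lborel. f x * convolve J \<psi> x)"
    by (simp add: convolve_def J_swap mult_ac flip: integral_mult_right_zero)
  finally show "(LINT x|lborel. convolve J f x * \<psi> x) = (LINT x|lborel. f x * convolve J \<psi> x)" .
qed

end

section \<open>Monotonicity and positivity from derivatives of real functions\<close>

text \<open>The mean value theorem. Only interior derivatives enter, which suits pairings with the
  solution: they are merely continuous at time \<open>0\<close>.\<close>

lemma increasing_if_deriv_nonneg:
  fixes f :: "real \<Rightarrow> real"
  assumes "a \<le> b" and "continuous_on {a..b} f"
    and "\<And>x. a < x \<Longrightarrow> x < b \<Longrightarrow> (f has_real_derivative f' x) (at x)"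
    and "\<And>x. a < x \<Longrightarrow> x < b \<Longrightarrow> 0 \<le> f' x"
  shows "f a \<le> f b"
proof (cases "a = b")
  case False
  then obtain l z where "a < z" "z < b" "(f has_real_derivative l) (at z)" "f b - f a = (b - a) * l"
    using MVT[of a b f] assms(1-3) by (fastforce simp: real_differentiable_def)
  moreover from this have "l = f' z" using assms(3) DERIV_unique by blast
  ultimately show ?thesis
    using assms(1,4) by (smt (verit) mult_nonneg_nonneg)
qed simp

text \<open>Iterating $g_n' = g_{n+1}$ improves the lower bound to $-M t^k/k!$ for every $k$.\<close>

lemma derivative_cascade_nonneg:
  fixes g :: "nat \<Rightarrow> real \<Rightarrow> real"
  assumes cont: "\<And>n. continuous_on {0..T} (g n)"
    and deriv: "\<And>n t. 0 < t \<Longrightarrow> t < T \<Longrightarrow> (g n has_real_derivative g (Suc n) t) (at t)"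
    and start: "\<And>n. 0 \<le> g n 0"
    and lower: "\<And>n t. 0 \<le> t \<Longrightarrow> t \<le> T \<Longrightarrow> - M \<le> g n t"
    and t: "0 \<le> t" "t \<le> T"
  shows "0 \<le> g n t"
proof -
  have *: "- (M * t ^ k / fact k) \<le> g n t" if "0 \<le> t" "t \<le> T" for k n t
    using that
  proof (induction k arbitrary: n t)
    case 0
    then show ?case using lower by simp
  next
    case (Suc k)
    \<comment> \<open>The added term is a primitive of \<open>M * s ^ k / fact k\<close>, so the
      induction hypothesis for \<open>g (Suc n)\<close> makes the derivative of \<open>?h\<close>
      nonnegative.\<close>
    let ?h = "\<lambda>t. g n t + M * t ^ Suc k / fact (Suc k)"
    have "?h 0 \<le> ?h t"
    proof (rule increasing_if_deriv_nonneg[where f = ?h and f' = "\<lambda>s. g (Suc n) s + M * s ^ k / fact k"])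
      show "continuous_on {0..t} ?h"
        using Suc.prems by (intro continuous_intros continuous_on_subset[OF cont]) auto
      show "(?h has_real_derivative g (Suc n) s + M * s ^ k / fact k) (at s)" if "0 < s" "s < t" for s
      proof -
        have "((\<lambda>s. M * s ^ Suc k / fact (Suc k)) has_real_derivative M * s ^ k / fact k) (at s)"
          by (auto intro!: derivative_eq_intros simp del: power_Suc)
        then show ?thesis
          using that Suc.prems by (auto intro!: DERIV_add deriv)
      qed
      show "0 \<le> g (Suc n) s + M * s ^ k / fact k" if "0 < s" "s < t" for s
        using Suc.IH[of s "Suc n"] that Suc.prems by simp
    qed (use Suc.prems in simp)
    then show ?case using start[of n] by simp
  qed
  have "(\<lambda>k. M * (t ^ k / fact k)) \<longlonglongrightarrow> M * 0"
    using summable_LIMSEQ_zero[OF summable_exp[of t]]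
    by (intro tendsto_intros) (simp add: divide_inverse mult.commute)
  then have "(\<lambda>k. - (M * t ^ k / fact k)) \<longlonglongrightarrow> 0"
    using tendsto_minus by fastforce
  then show ?thesis
    using *[OF t] by (intro LIMSEQ_le_const2[where a="g n t"]) auto
qed

section \<open>The weak formulation\<close>

locale exterior_walk = jump_kernel J for J +
  fixes H :: "plane set" and u :: "real \<Rightarrow> plane \<Rightarrow> real"
  assumes H_measurable [measurable]: "H \<in> sets borel"
    and u_integrable: "0 \<le> t \<Longrightarrow> integrable lborel (u t)"
    and u_continuous:
      "0 \<le> t \<Longrightarrow> ((\<lambda>s. LINT x|lborel. \<bar>u s x - u t x\<bar>) \<longlongrightarrow> 0) (at t within {0..})"
    and u_derivative: "0 < t \<Longrightarrow>
      ((\<lambda>s. LINT x:(- H)|lborel. \<bar>(u s x - u t x) / (s - t) - nonlocal_op J (u t) x\<bar>) \<longlongrightarrow> 0) (at t)"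
    and u_hole: "0 \<le> t \<Longrightarrow> AE x\<in>H in lborel. u t x = 0"
    and u_start_nonneg: "AE x in lborel. 0 \<le> u 0 x"
begin

text \<open>The expectation of \<open>\<psi>\<close> after one jump from \<open>x\<close>, where
  jumps landing in the hole contribute nothing: the transition operator of the walk killed in
  \<open>H\<close>.\<close>

definition killed :: "(plane \<Rightarrow> real) \<Rightarrow> plane \<Rightarrow> real" where
  "killed \<psi> = convolve J (\<lambda>y. indicator (- H) y * \<psi> y)"

definition pairing :: "real \<Rightarrow> (plane \<Rightarrow> real) \<Rightarrow> real" where
  "pairing t \<psi> = (LINT x|lborel. u t x * \<psi> x)"

lemma restrict_test: "bounded_test \<psi> \<Longrightarrow> bounded_test (\<lambda>y. indicator (- H) y * \<psi> y)"
  by (intro bounded_test_mult bounded_test_indicator) auto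

lemma killed_bound:
  assumes "bounded_test \<psi>" and "\<And>x. \<bar>\<psi> x\<bar> \<le> B"
  shows "\<bar>killed \<psi> x\<bar> \<le> B"
  unfolding killed_def using assms
  by (intro convolve_test restrict_test) (auto simp: indicator_def intro: order_trans[OF abs_ge_zero])

lemma killed_test: "bounded_test \<psi> \<Longrightarrow> bounded_test (killed \<psi>)"
  unfolding killed_def
  by (metis bounded_test_bound convolve_test(2) restrict_test)

lemma killed_mono:
  assumes "bounded_test f" "bounded_test g" and "\<And>y. f y \<le> g y"
  shows "killed f x \<le> killed g x"
  unfolding killed_def using assms
  by (intro convolve_mono restrict_test mult_left_mono) auto

lemma killed_nonneg: "bounded_test \<psi> \<Longrightarrow> (\<And>x. 0 \<le> \<psi> x) \<Longrightarrow> 0 \<le> killed \<psi> x"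
  using killed_mono[of "\<lambda>_. 0" \<psi> x] bounded_test_const[of 0] by (simp add: killed_def convolve_const)

lemma killed_le_convolve:
  assumes "bounded_test \<psi>" and "\<And>x. 0 \<le> \<psi> x"
  shows "killed \<psi> x \<le> convolve J \<psi> x"
  unfolding killed_def using assms
  by (intro convolve_mono restrict_test) (auto simp: indicator_def)

lemma pairing_integrable: "0 \<le> t \<Longrightarrow> bounded_test \<psi> \<Longrightarrow> integrable lborel (\<lambda>x. u t x * \<psi> x)"
  by (intro integrable_mult_bounded_test u_integrable)

lemma pairing_add:
  assumes "0 \<le> t" "bounded_test f" "bounded_test g"
  shows "pairing t (\<lambda>x. f x + g x) = pairing t f + pairing t g"
  using pairing_integrable[OF assms(1,2)] pairing_integrable[OF assms(1,3)]
  by (simp add: pairing_def distrib_left)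

lemma pairing_cmult: "pairing t (\<lambda>x. c * f x) = c * pairing t f"
  by (simp add: pairing_def mult.left_commute[of _ c])

lemma pairing_diff:
  assumes "0 \<le> t" "bounded_test f" "bounded_test g"
  shows "pairing t (\<lambda>x. f x - g x) = pairing t f - pairing t g"
  using pairing_integrable[OF assms(1,2)] pairing_integrable[OF assms(1,3)]
  by (simp add: pairing_def right_diff_distrib)

lemma pairing_continuous:
  assumes \<psi>: "bounded_test \<psi>"
  shows "continuous_on {0..} (\<lambda>t. pairing t \<psi>)"
  unfolding continuous_on_def
proof
  fix t :: real assume t: "t \<in> {0..}"
  obtain B where B: "\<And>x. \<bar>\<psi> x\<bar> \<le> B" using bounded_test_bound[OF \<psi>] by metis
  have "((\<lambda>s. pairing s \<psi> - pairing t \<psi>) \<longlongrightarrow> 0) (at t within {0..})"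
  proof (rule Lim_null_comparison)
    have "\<bar>pairing s \<psi> - pairing t \<psi>\<bar> \<le> (LINT x|lborel. \<bar>u s x - u t x\<bar>) * B" if "0 \<le> s" for s
      using abs_integral_mult_le[OF _ \<psi> B, of "\<lambda>x. u s x - u t x"]
        pairing_integrable[OF _ \<psi>, of s] pairing_integrable[OF _ \<psi>, of t] u_integrable[of s] u_integrable[of t] t that
      by (simp add: pairing_def left_diff_distrib)
    then show "\<forall>\<^sub>F s in at t within {0..}.
        norm (pairing s \<psi> - pairing t \<psi>) \<le> (LINT x|lborel. \<bar>u s x - u t x\<bar>) * B"
      by (auto simp: eventually_at_filter)
    show "((\<lambda>s. (LINT x|lborel. \<bar>u s x - u t x\<bar>) * B) \<longlongrightarrow> 0) (at t within {0..})"
      using tendsto_mult_right[OF u_continuous, of t B] t by simp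
  qed
  then show "((\<lambda>t. pairing t \<psi>) \<longlongrightarrow> pairing t \<psi>) (at t within {0..})"
    by (simp add: LIM_zero_iff)
qed

text \<open>The solution vanishes almost everywhere in the hole, so the values of a test function
  there are invisible.\<close>

lemma pairing_restrict:
  assumes "0 \<le> t" and [measurable]: "\<psi> \<in> borel_measurable borel"
  shows "(LINT x|lborel. u t x * (indicator (- H) x * \<psi> x)) = (LINT x|lborel. u t x * \<psi> x)"
proof -
  have [measurable]: "u t \<in> borel_measurable borel" using u_integrable[OF assms(1)] by auto
  show ?thesis
    using u_hole[OF assms(1)] by (intro integral_cong_AE) (auto simp: indicator_def)
qed

text \<open>The equation says that difference quotients converge in \<open>L^1\<close> of the
  complement of the hole. Testing this against a bounded function gives convergence of the quotients
  of the pairing, and self-adjointness puts the limit into the form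
  \<open>killed \<psi> - \<psi>\<close>.\<close>

lemma pairing_derivative:
  assumes \<psi>: "bounded_test \<psi>" and t: "0 < t"
  shows "((\<lambda>s. pairing s \<psi>) has_real_derivative (pairing t (killed \<psi>) - pairing t \<psi>)) (at t)"
proof -
  let ?\<chi> = "indicator (- H) :: plane \<Rightarrow> real"
  let ?q = "\<lambda>s x. (u s x - u t x) / (s - t) - nonlocal_op J (u t) x"
  let ?D = "pairing t (killed \<psi>) - pairing t \<psi>"
  obtain B where B: "\<And>x. \<bar>\<psi> x\<bar> \<le> B" using bounded_test_bound[OF \<psi>] by metis
  have [measurable]: "\<psi> \<in> borel_measurable borel" using \<psi> by (rule bounded_test_measurable)
  have \<chi>: "bounded_test ?\<chi>" by (intro bounded_test_indicator) auto
  have ut: "integrable lborel (u t)" using t by (intro u_integrable) simp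
  have c: "integrable lborel (convolve J (u t))"
    by (rule convolve_L1(1)[OF ut bounded_test_const])
  \<comment> \<open>Moving the convolution from \<open>\<psi>\<close> onto \<open>u t\<close> turns
    \<open>?D\<close> into an integral over the complement of the hole, where the equation
    holds.\<close>
  have D: "?D = (LINT x|lborel. convolve J (u t) x * (?\<chi> x * \<psi> x)) - (LINT x|lborel. u t x * (?\<chi> x * \<psi> x))"
    using t convolve_L1(2)[OF ut restrict_test[OF \<psi>]]
    by (simp add: pairing_restrict pairing_def killed_def)
  \<comment> \<open>The error of the difference quotient of the pairing is the residual of the
    equation tested against \<open>\<psi>\<close>, hence at most its \<open>L^1\<close> norm times
    \<open>B\<close>.\<close>
  have eq: "(pairing s \<psi> - pairing t \<psi>) / (s - t) - ?D = (LINT x|lborel. (?\<chi> x * ?q s x) * \<psi> x)"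
    and int: "integrable lborel (\<lambda>x. ?\<chi> x * ?q s x)"
    if s: "0 < s" for s
  proof -
    have us: "integrable lborel (u s)" using s by (intro u_integrable) simp
    have q: "integrable lborel (?q s)"
      using us ut c by (auto simp: nonlocal_op_def)
    show "integrable lborel (\<lambda>x. ?\<chi> x * ?q s x)"
      using integrable_mult_bounded_test[OF q \<chi>] by (simp add: mult.commute)
    note ints = integrable_mult_bounded_test[OF _ restrict_test[OF \<psi>]]
    have "(LINT x|lborel. (?\<chi> x * ?q s x) * \<psi> x)
       = (LINT x|lborel. (u s x * (?\<chi> x * \<psi> x) - u t x * (?\<chi> x * \<psi> x)) / (s - t)
            - (convolve J (u t) x * (?\<chi> x * \<psi> x) - u t x * (?\<chi> x * \<psi> x)))"
      by (intro Bochner_Integration.integral_cong)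
        (auto simp: nonlocal_op_def algebra_simps diff_divide_distrib)
    also have "\<dots> = ((LINT x|lborel. u s x * (?\<chi> x * \<psi> x)) - (LINT x|lborel. u t x * (?\<chi> x * \<psi> x))) / (s - t) - ?D"
      using ints[OF us] ints[OF ut] ints[OF c] by (simp add: D)
    finally show "(pairing s \<psi> - pairing t \<psi>) / (s - t) - ?D = (LINT x|lborel. (?\<chi> x * ?q s x) * \<psi> x)"
      using s t by (simp add: pairing_restrict pairing_def)
  qed
  have "((\<lambda>s. (pairing s \<psi> - pairing t \<psi>) / (s - t) - ?D) \<longlongrightarrow> 0) (at t)"
  proof (rule Lim_null_comparison)
    have "\<bar>(pairing s \<psi> - pairing t \<psi>) / (s - t) - ?D\<bar> \<le> (LINT x:(- H)|lborel. \<bar>?q s x\<bar>) * B" if "0 < s" for s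
    proof -
      have "(LINT x|lborel. \<bar>?\<chi> x * ?q s x\<bar>) = (LINT x:(- H)|lborel. \<bar>?q s x\<bar>)"
        by (simp add: set_lebesgue_integral_def abs_mult)
      then show ?thesis
        using abs_integral_mult_le[OF int[OF that] \<psi> B] unfolding eq[OF that] by metis
    qed
    moreover have "\<forall>\<^sub>F s in at t. 0 < s"
      using order_tendstoD(1)[OF tendsto_ident_at t] .
    ultimately show "\<forall>\<^sub>F s in at t.
        norm ((pairing s \<psi> - pairing t \<psi>) / (s - t) - ?D) \<le> (LINT x:(- H)|lborel. \<bar>?q s x\<bar>) * B"
      by (simp add: eventually_mono)
    show "((\<lambda>s. (LINT x:(- H)|lborel. \<bar>?q s x\<bar>) * B) \<longlongrightarrow> 0) (at t)"
      using tendsto_mult_right[OF u_derivative[OF t], of B] by simp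
  qed
  then show ?thesis by (simp add: has_field_derivative_iff LIM_zero_iff)
qed

section \<open>Positivity of the solution\<close>

lemma funpow_killed_test: "bounded_test \<psi> \<Longrightarrow> bounded_test ((killed ^^ n) \<psi>)"
  by (induction n) (auto intro: killed_test)

lemma funpow_killed_bound:
  "bounded_test \<psi> \<Longrightarrow> (\<And>x. \<bar>\<psi> x\<bar> \<le> B) \<Longrightarrow> \<bar>(killed ^^ n) \<psi> x\<bar> \<le> B"
  by (induction n arbitrary: x) (auto intro: killed_bound funpow_killed_test)

lemma funpow_killed_nonneg:
  "bounded_test \<psi> \<Longrightarrow> (\<And>x. 0 \<le> \<psi> x) \<Longrightarrow> 0 \<le> (killed ^^ n) \<psi> x"
  by (induction n arbitrary: x) (auto intro: killed_nonneg funpow_killed_test)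

text \<open>Continuity into \<open>L^1\<close> makes the norm a continuous function of time, hence
  bounded on a compact interval.\<close>

lemma L1_norm_bounded: "\<exists>M. \<forall>t\<in>{0..T}. (LINT x|lborel. \<bar>u t x\<bar>) \<le> M"
proof -
  have "continuous_on {0..} (\<lambda>t. LINT x|lborel. \<bar>u t x\<bar>)"
    unfolding continuous_on_def
  proof
    fix t :: real assume t: "t \<in> {0..}"
    have "((\<lambda>s. (LINT x|lborel. \<bar>u s x\<bar>) - (LINT x|lborel. \<bar>u t x\<bar>)) \<longlongrightarrow> 0) (at t within {0..})"
    proof (rule Lim_null_comparison)
      have "norm ((LINT x|lborel. \<bar>u s x\<bar>) - (LINT x|lborel. \<bar>u t x\<bar>)) \<le> (LINT x|lborel. \<bar>u s x - u t x\<bar>)"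
        if "0 \<le> s" for s
      proof -
        have i: "integrable lborel (u s)" "integrable lborel (u t)" using u_integrable that t by auto
        then have "(LINT x|lborel. \<bar>u s x\<bar>) - (LINT x|lborel. \<bar>u t x\<bar>) = (LINT x|lborel. \<bar>u s x\<bar> - \<bar>u t x\<bar>)"
          by simp
        moreover have "\<bar>LINT x|lborel. \<bar>u s x\<bar> - \<bar>u t x\<bar>\<bar> \<le> (LINT x|lborel. \<bar>\<bar>u s x\<bar> - \<bar>u t x\<bar>\<bar>)"
          by (rule integral_abs_bound)
        moreover have "(LINT x|lborel. \<bar>\<bar>u s x\<bar> - \<bar>u t x\<bar>\<bar>) \<le> (LINT x|lborel. \<bar>u s x - u t x\<bar>)"
          using i by (intro integral_mono) auto
        ultimately show ?thesis by (simp only: real_norm_def)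
      qed
      then show "\<forall>\<^sub>F s in at t within {0..}.
          norm ((LINT x|lborel. \<bar>u s x\<bar>) - (LINT x|lborel. \<bar>u t x\<bar>)) \<le> (LINT x|lborel. \<bar>u s x - u t x\<bar>)"
        by (auto simp: eventually_at_filter)
    qed (use u_continuous t in auto)
    then show "((\<lambda>t. LINT x|lborel. \<bar>u t x\<bar>) \<longlongrightarrow> (LINT x|lborel. \<bar>u t x\<bar>)) (at t within {0..})"
      by (simp add: LIM_zero_iff)
  qed
  then have "continuous_on {0..T} (\<lambda>t. LINT x|lborel. \<bar>u t x\<bar>)"
    by (rule continuous_on_subset) auto
  then have "compact ((\<lambda>t. LINT x|lborel. \<bar>u t x\<bar>) ` {0..T})"
    by (intro compact_continuous_image) auto
  then show ?thesis
    using compact_imp_bounded bounded_imp_bdd_above by (fastforce simp: bdd_above_def)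
qed

text \<open>The factor \<open>exp t\<close> cancels the loss term, so that \<open>?g n\<close> has
  derivative \<open>?g (Suc n)\<close>. Every \<open>?g n\<close> starts nonnegative because
  \<open>killed\<close> preserves positivity, and all share one lower bound on \<open>{0..t}\<close>
  because \<open>killed\<close> does not increase sup bounds. The derivative cascade then
  applies.\<close>

lemma pairing_nonneg:
  assumes \<psi>: "bounded_test \<psi>" and nonneg: "\<And>x. 0 \<le> \<psi> x" and t: "0 \<le> t"
  shows "0 \<le> pairing t \<psi>"
proof -
  let ?g = "\<lambda>n t. exp t * pairing t ((killed ^^ n) \<psi>)"
  note test = funpow_killed_test[OF \<psi>]
  obtain M where M: "\<And>s. 0 \<le> s \<Longrightarrow> s \<le> t \<Longrightarrow> (LINT x|lborel. \<bar>u s x\<bar>) \<le> M"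
    using L1_norm_bounded[of t] by (meson atLeastAtMost_iff)
  obtain B where B: "0 \<le> B" "\<And>x. \<bar>\<psi> x\<bar> \<le> B" using bounded_test_bound[OF \<psi>] by metis
  have "0 \<le> ?g 0 t"
  proof (rule derivative_cascade_nonneg[where T=t and g="?g" and M="exp t * (M * B)"])
    show "continuous_on {0..t} (?g n)" for n
      by (intro continuous_intros continuous_on_subset[OF pairing_continuous[OF test]]) auto
    show "(?g n has_real_derivative ?g (Suc n) s) (at s)" if "0 < s" "s < t" for n s
      using DERIV_mult[OF DERIV_exp pairing_derivative[OF test that(1)], of n]
      by (simp add: right_diff_distrib mult.commute[of _ "exp s"])
    show "0 \<le> ?g n 0" for n
      unfolding pairing_def using u_start_nonneg funpow_killed_nonneg[OF \<psi> nonneg]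
      by (intro mult_nonneg_nonneg integral_nonneg_AE) auto
    show "- (exp t * (M * B)) \<le> ?g n s" if s: "0 \<le> s" "s \<le> t" for n s
    proof -
      have "\<bar>pairing s ((killed ^^ n) \<psi>)\<bar> \<le> (LINT x|lborel. \<bar>u s x\<bar>) * B"
        unfolding pairing_def using s
        by (intro abs_integral_mult_le u_integrable test funpow_killed_bound[OF \<psi> B(2)]) auto
      also have "\<dots> \<le> M * B" using M[OF s] B by (intro mult_right_mono)
      finally have *: "\<bar>pairing s ((killed ^^ n) \<psi>)\<bar> \<le> M * B" .
      have "exp s * \<bar>pairing s ((killed ^^ n) \<psi>)\<bar> \<le> exp t * (M * B)"
        using s * by (intro mult_mono) auto
      then have "\<bar>exp s * pairing s ((killed ^^ n) \<psi>)\<bar> \<le> exp t * (M * B)"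
        by (simp add: abs_mult)
      then show ?thesis by linarith
    qed
  qed (use t in auto)
  then show ?thesis by (simp add: zero_le_mult_iff)
qed

text \<open>Tested against the indicator of the set where \<open>u t\<close> is negative, the
  pairing is nonnegative while its integrand is nonpositive, so the integrand vanishes almost
  everywhere.\<close>

lemma u_nonneg:
  assumes t: "0 \<le> t"
  shows "AE x in lborel. 0 \<le> u t x"
proof -
  have [measurable]: "u t \<in> borel_measurable borel" using u_integrable[OF t] by auto
  let ?N = "{x. u t x < 0}"
  have N: "bounded_test (indicator ?N :: plane \<Rightarrow> real)" by (intro bounded_test_indicator) auto
  have "0 \<le> pairing t (indicator ?N)" using N t by (intro pairing_nonneg) auto
  moreover have "integrable lborel (\<lambda>x. - (u t x * indicator ?N x))"
    using pairing_integrable[OF t N] by simp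
  moreover have "0 \<le> (LINT x|lborel. - (u t x * indicator ?N x))"
    by (intro Bochner_Integration.integral_nonneg) (auto simp: indicator_def)
  ultimately have "AE x in lborel. - (u t x * indicator ?N x) = 0"
    by (subst integral_nonneg_eq_0_iff_AE[symmetric]) (auto simp: pairing_def indicator_def)
  then show ?thesis by eventually_elim (auto simp: indicator_def split: if_splits)
qed

end

section \<open>Mass, logarithmic moment and occupation times\<close>

locale log_exterior_walk = exterior_walk J H u for J H u +
  fixes d :: real
  assumes J_range: "\<And>x. d \<le> norm x \<Longrightarrow> J x = 0"
    and hole_contains: "ball 0 2 \<subseteq> H"
    and u_start_log: "integrable lborel (\<lambda>x. u 0 x * ln (norm x))"
begin

lemma pairing_mono:
  assumes f: "bounded_test f" and g: "bounded_test g" and t: "0 \<le> t"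
    and le: "AE x\<in>- H in lborel. f x \<le> g x"
  shows "pairing t f \<le> pairing t g"
  unfolding pairing_def
proof (rule integral_mono_AE)
  show "AE x in lborel. u t x * f x \<le> u t x * g x"
    using u_nonneg[OF t] u_hole[OF t] le
    by eventually_elim (auto intro: mult_left_mono)
qed (use assms pairing_integrable in auto)

lemma pairing_growth:
  assumes \<psi>: "bounded_test \<psi>" and st: "0 \<le> s" "s \<le> t"
    and D: "\<And>r. 0 < r \<Longrightarrow> pairing r (killed \<psi>) - pairing r \<psi> \<le> D"
  shows "pairing t \<psi> \<le> pairing s \<psi> + D * (t - s)"
proof -
  let ?h = "\<lambda>r. D * r - pairing r \<psi>"
  have "?h s \<le> ?h t"
  proof (rule increasing_if_deriv_nonneg[where f = ?h and
        f' = "\<lambda>r. D - (pairing r (killed \<psi>) - pairing r \<psi>)"])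
    show "continuous_on {s..t} ?h"
      using st by (intro continuous_intros continuous_on_subset[OF pairing_continuous[OF \<psi>]]) auto
    show "(?h has_real_derivative D - (pairing r (killed \<psi>) - pairing r \<psi>)) (at r)"
      if "s < r" "r < t" for r
      using that st by (auto intro!: derivative_eq_intros pairing_derivative[OF \<psi>])
    show "0 \<le> D - (pairing r (killed \<psi>) - pairing r \<psi>)" if "s < r" "r < t" for r
      using D[of r] that st by simp
  qed fact
  then show ?thesis by (simp add: algebra_simps)
qed

abbreviation mass :: "real \<Rightarrow> real" where
  "mass t \<equiv> pairing t (\<lambda>_. 1)"

lemma killed_one_le: "killed (\<lambda>_. 1) x \<le> 1"
  using killed_le_convolve[OF bounded_test_const[of 1], of x] by (simp add: convolve_const)

text \<open>The drift of the constant \<open>1\<close> is \<open>killed (\<lambda>_. 1) - 1\<close>,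
  which is nonpositive: mass is only lost into the hole.\<close>

lemma mass_antimono:
  assumes "0 \<le> s" "s \<le> t"
  shows "mass t \<le> mass s"
proof -
  have "pairing r (killed (\<lambda>_. 1)) \<le> mass r" if "0 < r" for r
    using that killed_one_le by (intro pairing_mono killed_test bounded_test_const) auto
  then have "mass t \<le> mass s + 0 * (t - s)"
    using assms by (intro pairing_growth bounded_test_const) auto
  then show ?thesis by simp
qed

lemma mass_nonneg: "0 \<le> t \<Longrightarrow> 0 \<le> mass t"
  by (intro pairing_nonneg bounded_test_const) auto

text \<open>A pointwise drift of at most \<open>c\<close> outside the hole, integrated against
  \<open>u r\<close>, gives growth rate at most \<open>c * mass r\<close>, and the mass never
  exceeds its initial value.\<close>

lemma pairing_drift:
  assumes \<psi>: "bounded_test \<psi>" and c: "0 \<le> c" and t: "0 \<le> t"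
    and drift: "AE x\<in>- H in lborel. killed \<psi> x - \<psi> x \<le> c"
  shows "pairing t \<psi> \<le> pairing 0 \<psi> + c * mass 0 * t"
proof -
  have "pairing r (killed \<psi>) - pairing r \<psi> \<le> c * mass 0" if r: "0 < r" for r
  proof -
    have "bounded_test (\<lambda>x. killed \<psi> x - \<psi> x)"
      using bounded_test_add[OF killed_test[OF \<psi>] bounded_test_mult[OF bounded_test_const[of "-1"] \<psi>]]
      by simp
    then have "pairing r (\<lambda>x. killed \<psi> x - \<psi> x) \<le> pairing r (\<lambda>_. c * 1)"
      using r drift by (intro pairing_mono bounded_test_const) auto
    also have "\<dots> = c * mass r" by (rule pairing_cmult)
    also have "\<dots> \<le> c * mass 0" using r c by (intro mult_left_mono mass_antimono) auto
    finally show ?thesis using r \<psi> by (simp add: pairing_diff killed_test)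
  qed
  from pairing_growth[OF \<psi> _ t this] show ?thesis by simp
qed

text \<open>The truncation makes the logarithm $1$-Lipschitz; it changes nothing outside the hole.\<close>

definition logp :: "plane \<Rightarrow> real" where
  "logp x = ln (max 2 (norm x))"

lemma logp_measurable [measurable]: "logp \<in> borel_measurable borel"
  unfolding logp_def by measurable

lemma logp_nonneg: "0 \<le> logp x"
  by (simp add: logp_def)

lemma logp_outside: "x \<notin> H \<Longrightarrow> logp x = ln (norm x)"
  using hole_contains by (auto simp: logp_def max_def subset_iff)

lemma logp_lipschitz: "logp x \<le> logp y + norm (x - y)"
proof -
  let ?a = "max 2 (norm x)" and ?b = "max 2 (norm y)"
  have "ln ?a - ln ?b \<le> (?a - ?b) / ?b" by (rule ln_diff_le) auto
  also have "\<dots> \<le> norm (x - y)"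
  proof (cases "?a \<le> ?b")
    case True
    then have "(?a - ?b) / ?b \<le> 0" by (intro divide_nonpos_pos) auto
    then show ?thesis using norm_ge_zero[of "x - y"] by linarith
  next
    case False
    then have "(?a - ?b) / ?b \<le> (?a - ?b) / 1" by (intro divide_left_mono) auto
    also have "\<dots> \<le> norm (x - y)" using norm_triangle_ineq2[of x y]
      by (auto simp: max_def intro: order_trans[OF _ norm_ge_zero])
    finally show ?thesis .
  qed
  finally show ?thesis by (simp add: logp_def)
qed

section \<open>Finiteness of the logarithmic moment\<close>

lemma pairing_log_AE:
  "0 \<le> t \<Longrightarrow> AE x in lborel. u t x * ln (norm x) = u t x * logp x"
  using u_hole[of t] by (auto simp: logp_outside elim!: eventually_mono)

lemma u_measurable: "0 \<le> t \<Longrightarrow> u t \<in> borel_measurable borel"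
  using u_integrable by auto

text \<open>\<open>J (x - y)\<close> is a probability density in \<open>y\<close> that vanishes at
  distance \<open>d\<close> or more from \<open>x\<close>, so an upper bound within jump range of
  \<open>x\<close> suffices.\<close>

lemma convolve_dominated:
  assumes f: "bounded_test f" and le: "\<And>y. norm (x - y) < d \<Longrightarrow> f y \<le> b"
  shows "convolve J f x \<le> b"
proof -
  have "J (x - y) * f y \<le> J (x - y) * b" for y
    using J_range[of "x - y"] le[of y] J_nonneg[of "x - y"]
    by (cases "norm (x - y) < d") (auto intro: mult_left_mono)
  then have "convolve J f x \<le> convolve J (\<lambda>_. b) x"
    unfolding convolve_def using f J_shift_integrable
    by (intro integral_mono integrable_convolve_test bounded_test_const) auto
  then show ?thesis by (simp add: convolve_const)
qed

lemma range_nonneg: "0 \<le> d"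
proof (rule ccontr)
  assume "\<not> 0 \<le> d"
  then have "J x = 0" for x
    using J_range[of x] norm_ge_zero[of x] by linarith
  then show False using J_integral by simp
qed

text \<open>The truncations \<open>min (logp x) (real i)\<close> are bounded test functions. They
  are 1-Lipschitz and jumps are shorter than \<open>d\<close>, so their drift is at most
  \<open>d\<close> for every \<open>i\<close>. Their pairings therefore increase in \<open>i\<close>
  below a bound independent of \<open>i\<close>, and monotone convergence applies.\<close>

lemma log_moment:
  assumes t: "0 \<le> t"
  shows "integrable lborel (\<lambda>x. u t x * logp x)"
proof -
  let ?\<psi> = "\<lambda>i x. min (logp x) (real i)"
  have [measurable]: "u t \<in> borel_measurable borel" "u 0 \<in> borel_measurable borel"
    using t by (auto intro: u_measurable)
  have test: "bounded_test (?\<psi> i)" for i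
    using logp_nonneg by (intro bounded_testI[where B = "real i"]) (auto simp: min_def)
  have start: "integrable lborel (\<lambda>x. u 0 x * logp x)"
    using integrable_cong_AE[THEN iffD1, OF _ _ pairing_log_AE u_start_log] by auto
  have bound: "pairing t (?\<psi> i) \<le> (LINT x|lborel. u 0 x * logp x) + d * mass 0 * t" for i
  proof -
    have "killed (?\<psi> i) x \<le> ?\<psi> i x + d" for x
    proof -
      have "killed (?\<psi> i) x \<le> convolve J (?\<psi> i) x"
        using logp_nonneg by (intro killed_le_convolve test) auto
      also have "\<dots> \<le> ?\<psi> i x + d"
      proof (rule convolve_dominated[OF test])
        show "?\<psi> i y \<le> ?\<psi> i x + d" if "norm (x - y) < d" for y
          using logp_lipschitz[of y x] that range_nonneg
          by (simp add: norm_minus_commute min_def)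
      qed
      finally show ?thesis .
    qed
    then have "AE x\<in>- H in lborel. killed (?\<psi> i) x - ?\<psi> i x \<le> d"
      by (simp add: algebra_simps)
    then have "pairing t (?\<psi> i) \<le> pairing 0 (?\<psi> i) + d * mass 0 * t"
      by (intro pairing_drift test range_nonneg t)
    moreover have "pairing 0 (?\<psi> i) \<le> (LINT x|lborel. u 0 x * logp x)"
      unfolding pairing_def using u_start_nonneg start pairing_integrable[OF _ test]
      by (intro integral_mono_AE) (auto intro: mult_left_mono elim!: eventually_mono)
    ultimately show ?thesis by simp
  qed
  have "incseq (\<lambda>i. pairing t (?\<psi> i))"
    unfolding incseq_def using t by (auto intro!: pairing_mono test)
  then obtain l where l: "(\<lambda>i. pairing t (?\<psi> i)) \<longlonglongrightarrow> l"
    using bound incseq_convergent by blast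
  show ?thesis
  proof (rule integrable_monotone_convergence)
    show "integrable lborel (\<lambda>x. u t x * ?\<psi> i x)" for i
      using pairing_integrable[OF t test] .
    show "AE x in lborel. mono (\<lambda>i. u t x * ?\<psi> i x)"
      using u_nonneg[OF t] by eventually_elim (auto simp: mono_def intro!: mult_left_mono)
    show "AE x in lborel. (\<lambda>i. u t x * ?\<psi> i x) \<longlonglongrightarrow> u t x * logp x"
    proof (rule AE_I2)
      fix x
      have "\<forall>\<^sub>F i in sequentially. ?\<psi> i x = logp x"
        using eventually_ge_at_top[of "nat \<lceil>logp x\<rceil>"]
        by eventually_elim (auto simp: min_def nat_le_iff ceiling_le_iff)
      then have "(\<lambda>i. ?\<psi> i x) \<longlonglongrightarrow> logp x" by (rule tendsto_eventually)
      then show "(\<lambda>i. u t x * ?\<psi> i x) \<longlonglongrightarrow> u t x * logp x" by (intro tendsto_intros)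
    qed
    show "(\<lambda>i. LINT x|lborel. u t x * ?\<psi> i x) \<longlonglongrightarrow> l" using l by (simp add: pairing_def)
  qed measurable
qed

section \<open>Occupation times: time integrals of pairings\<close>

text \<open>For nonnegative \<open>\<psi>\<close> this says that the total time spent in
  \<open>\<psi>\<close>, weighted by mass, is finite. A bound uniform in \<open>T\<close> replaces
  an improper integral.\<close>

definition occupation_bounded :: "(plane \<Rightarrow> real) \<Rightarrow> bool" where
  "occupation_bounded \<psi> \<longleftrightarrow> (\<exists>C. \<forall>T\<ge>0. integral {0..T} (\<lambda>t. pairing t \<psi>) \<le> C)"

lemma pairing_integrable_on: "bounded_test \<psi> \<Longrightarrow> (\<lambda>t. pairing t \<psi>) integrable_on {0..T}"
  by (intro integrable_continuous_real continuous_on_subset[OF pairing_continuous]) auto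

text \<open>The weak equation integrated over time. The version of the fundamental theorem with
  interior derivatives is used because the derivative is known only at positive times.\<close>

lemma occupation_identity:
  assumes \<psi>: "bounded_test \<psi>" and T: "0 \<le> T"
  shows "integral {0..T} (\<lambda>t. pairing t (killed \<psi>)) - integral {0..T} (\<lambda>t. pairing t \<psi>)
    = pairing T \<psi> - pairing 0 \<psi>"
proof -
  have "((\<lambda>t. pairing t (killed \<psi>) - pairing t \<psi>) has_integral (pairing T \<psi> - pairing 0 \<psi>)) {0..T}"
    using \<psi> T
    by (intro fundamental_theorem_of_calculus_interior continuous_on_subset[OF pairing_continuous])
      (auto intro!: pairing_derivative simp: has_real_derivative_iff_has_vector_derivative[symmetric])
  then show ?thesis
    using Henstock_Kurzweil_Integration.integral_diff[OF pairing_integrable_on[OF killed_test[OF \<psi>]] pairing_integrable_on[OF \<psi>], of T]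
    by (simp add: integral_unique)
qed

lemma occupation_mono:
  assumes "occupation_bounded g" "bounded_test f" "bounded_test g" "\<And>x. f x \<le> g x"
  shows "occupation_bounded f"
proof -
  obtain C where C: "\<And>T. 0 \<le> T \<Longrightarrow> integral {0..T} (\<lambda>t. pairing t g) \<le> C"
    using assms(1) by (auto simp: occupation_bounded_def)
  have "integral {0..T} (\<lambda>t. pairing t f) \<le> integral {0..T} (\<lambda>t. pairing t g)" if "0 \<le> T" for T
    using assms that by (intro integral_le pairing_integrable_on pairing_mono) auto
  then show ?thesis
    unfolding occupation_bounded_def using C order_trans by blast
qed

lemma occupation_add:
  assumes "occupation_bounded f" "occupation_bounded g" and t: "bounded_test f" "bounded_test g"
  shows "occupation_bounded (\<lambda>x. f x + g x)"
proof -
  obtain B C where BC: "\<And>T. 0 \<le> T \<Longrightarrow> integral {0..T} (\<lambda>t. pairing t f) \<le> B"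
      "\<And>T. 0 \<le> T \<Longrightarrow> integral {0..T} (\<lambda>t. pairing t g) \<le> C"
    using assms(1,2) unfolding occupation_bounded_def by metis
  have "integral {0..T} (\<lambda>t. pairing t (\<lambda>x. f x + g x)) \<le> B + C" if T: "0 \<le> T" for T
  proof -
    have "integral {0..T} (\<lambda>t. pairing t (\<lambda>x. f x + g x)) = integral {0..T} (\<lambda>t. pairing t f + pairing t g)"
      using t by (intro integral_cong) (auto simp: pairing_add)
    also have "\<dots> = integral {0..T} (\<lambda>t. pairing t f) + integral {0..T} (\<lambda>t. pairing t g)"
      using t by (intro integral_add pairing_integrable_on)
    finally show ?thesis using BC[OF T] by simp
  qed
  then show ?thesis unfolding occupation_bounded_def by blast
qed

lemma occupation_cmult:
  assumes "occupation_bounded f" and "0 \<le> c"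
  shows "occupation_bounded (\<lambda>x. c * f x)"
proof -
  obtain C where "\<And>T. 0 \<le> T \<Longrightarrow> integral {0..T} (\<lambda>t. pairing t f) \<le> C"
    using assms(1) by (auto simp: occupation_bounded_def)
  then have "\<And>T. 0 \<le> T \<Longrightarrow> integral {0..T} (\<lambda>t. pairing t (\<lambda>x. c * f x)) \<le> c * C"
    using assms(2) by (simp add: pairing_cmult mult_left_mono)
  then show ?thesis unfolding occupation_bounded_def by blast
qed

lemma occupation_zero: "occupation_bounded (\<lambda>_. 0)"
  by (auto simp: occupation_bounded_def pairing_def)

lemma occupation_sum:
  assumes "\<And>i. i \<in> I \<Longrightarrow> occupation_bounded (f i)" and "\<And>i. i \<in> I \<Longrightarrow> bounded_test (f i)"
  shows "occupation_bounded (\<lambda>x. \<Sum>i\<in>I. f i x)"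
  using assms by (induction I rule: infinite_finite_induct)
    (auto intro!: occupation_add bounded_test_sum occupation_zero)

text \<open>By the occupation identity the two time integrals differ by the pairings at the
  endpoints, and the one at \<open>T\<close> is at most \<open>B * mass 0\<close>.\<close>

lemma occupation_killed:
  assumes \<psi>: "bounded_test \<psi>" "\<And>x. 0 \<le> \<psi> x" and occ: "occupation_bounded \<psi>"
  shows "occupation_bounded (killed \<psi>)"
proof -
  obtain C where C: "\<And>T. 0 \<le> T \<Longrightarrow> integral {0..T} (\<lambda>t. pairing t \<psi>) \<le> C"
    using occ by (auto simp: occupation_bounded_def)
  obtain B where B: "0 \<le> B" "\<And>x. \<bar>\<psi> x\<bar> \<le> B" using bounded_test_bound[OF \<psi>(1)] by metis
  have "integral {0..T} (\<lambda>t. pairing t (killed \<psi>)) \<le> C + B * mass 0" if T: "0 \<le> T" for T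
  proof -
    have "pairing T \<psi> \<le> pairing T (\<lambda>_. B * 1)"
      using B T \<psi>(1) by (intro pairing_mono bounded_test_const) (auto simp: abs_le_iff)
    also have "\<dots> = B * mass T" by (rule pairing_cmult)
    also have "\<dots> \<le> B * mass 0" using T B by (intro mult_left_mono mass_antimono) auto
    finally show ?thesis
      using occupation_identity[OF \<psi>(1) T] C[OF T] pairing_nonneg[OF \<psi>, of 0] by simp
  qed
  then show ?thesis unfolding occupation_bounded_def by blast
qed

lemma escape_test: "bounded_test (\<lambda>x. 1 - killed (\<lambda>_. 1) x)"
  using bounded_test_add[OF bounded_test_const[of 1]
      bounded_test_mult[OF bounded_test_const[of "-1"] killed_test[OF bounded_test_const[of 1]]]]
  by simp

text \<open>\<open>1 - killed (\<lambda>_. 1) x\<close> is the probability of jumping from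
  \<open>x\<close> into the hole. Its time integral is the mass lost up to \<open>T\<close>, hence
  at most \<open>mass 0\<close>.\<close>

lemma occupation_escape: "occupation_bounded (\<lambda>x. 1 - killed (\<lambda>_. 1) x)"
proof -
  note one = bounded_test_const[of 1]
  have "integral {0..T} (\<lambda>t. pairing t (\<lambda>x. 1 - killed (\<lambda>_. 1) x)) \<le> mass 0" if T: "0 \<le> T" for T
  proof -
    have "integral {0..T} (\<lambda>t. pairing t (\<lambda>x. 1 - killed (\<lambda>_. 1) x))
        = integral {0..T} (\<lambda>t. mass t - pairing t (killed (\<lambda>_. 1)))"
      by (intro integral_cong) (auto intro!: pairing_diff one killed_test)
    also have "\<dots> = integral {0..T} mass - integral {0..T} (\<lambda>t. pairing t (killed (\<lambda>_. 1)))"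
      by (intro Henstock_Kurzweil_Integration.integral_diff pairing_integrable_on one killed_test)
    finally show ?thesis
      using occupation_identity[OF one T] mass_nonneg[OF T] by simp
  qed
  then show ?thesis unfolding occupation_bounded_def by blast
qed

text \<open>The part of the convolution missing from \<open>killed \<psi>\<close> comes from the
  hole and is at most \<open>B\<close> times the escape probability. Passing to the full convolution
  lets bounds spread from balls inside the hole, which \<open>killed\<close> cannot see.\<close>

lemma occupation_convolve:
  assumes \<psi>: "bounded_test \<psi>" "\<And>x. 0 \<le> \<psi> x" and occ: "occupation_bounded \<psi>"
  shows "occupation_bounded (convolve J \<psi>)"
proof -
  obtain B where B: "0 \<le> B" "\<And>x. \<bar>\<psi> x\<bar> \<le> B" using bounded_test_bound[OF \<psi>(1)] by metis
  have split: "killed f x + (LINT y|lborel. J (x - y) * (indicator H y * f y)) = convolve J f x"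
    if f: "bounded_test f" for f x
  proof -
    have "bounded_test (\<lambda>y. indicator H y * f y)"
      using f by (intro bounded_test_mult bounded_test_indicator) auto
    then have "killed f x + (LINT y|lborel. J (x - y) * (indicator H y * f y))
      = (LINT y|lborel. J (x - y) * (indicator (- H) y * f y) + J (x - y) * (indicator H y * f y))"
      unfolding killed_def convolve_def using f
      by (intro Bochner_Integration.integral_add[symmetric] integrable_convolve_test restrict_test)
    also have "\<dots> = convolve J f x"
      unfolding convolve_def by (intro Bochner_Integration.integral_cong) (auto simp: indicator_def)
    finally show ?thesis .
  qed
  have "convolve J \<psi> x \<le> killed \<psi> x + B * (1 - killed (\<lambda>_. 1) x)" for x
  proof -
    have "(LINT y|lborel. J (x - y) * (indicator H y * \<psi> y)) \<le> (LINT y|lborel. B * (J (x - y) * (indicator H y * 1)))"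
    proof (rule integral_mono)
      show "integrable lborel (\<lambda>y. J (x - y) * (indicator H y * \<psi> y))"
        using \<psi> by (intro integrable_convolve_test bounded_test_mult bounded_test_indicator) auto
      show "integrable lborel (\<lambda>y. B * (J (x - y) * (indicator H y * 1)))"
        by (intro integrable_mult_right integrable_convolve_test bounded_test_mult
            bounded_test_indicator bounded_test_const) auto
      show "J (x - y) * (indicator H y * \<psi> y) \<le> B * (J (x - y) * (indicator H y * 1))" for y
        using B(2)[of y] J_nonneg[of "x - y"]
        by (auto simp: indicator_def abs_le_iff mult.commute intro: mult_right_mono)
    qed
    also have "\<dots> = B * (1 - killed (\<lambda>_. 1) x)"
      using split[OF bounded_test_const[of 1], of x] by (simp add: convolve_const)
    finally show ?thesis using split[OF \<psi>(1), of x] by simp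
  qed
  note le = this
  have escape: "occupation_bounded (\<lambda>x. B * (1 - killed (\<lambda>_. 1) x))"
      "bounded_test (\<lambda>x. B * (1 - killed (\<lambda>_. 1) x))"
    by (rule occupation_cmult[OF occupation_escape B(1)],
        rule bounded_test_mult[OF bounded_test_const escape_test])
  show ?thesis
    by (rule occupation_mono[OF
          occupation_add[OF occupation_killed[OF \<psi> occ] escape(1) killed_test[OF \<psi>(1)] escape(2)]
          convolve_test(2)[OF \<psi>(1) B(2)]
          bounded_test_add[OF killed_test[OF \<psi>(1)] escape(2)] le])
qed

section \<open>Spreading of finite occupation from the hole to every ball\<close>

text \<open>Points of the two balls are less than \<open>3 * r\<close> apart, so the convolution of
  \<open>J\<close> with the indicator of the first ball is at least \<open>j\<close> times the area
  of that ball everywhere on the second. The rescaled convolution dominates the new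
  indicator.\<close>

lemma occupation_ball_step:
  assumes occ: "occupation_bounded (indicator (ball c r))" and r: "0 < r"
    and j: "0 < j" and J_lower: "\<forall>x. norm x < 3 * r \<longrightarrow> j \<le> J x"
    and c': "dist c c' \<le> r"
  shows "occupation_bounded (indicator (ball c' r))"
proof -
  have test: "bounded_test (indicator (ball a r) :: plane \<Rightarrow> real)" for a
    by (intro bounded_test_indicator) auto
  let ?m = "measure lborel (ball c r)"
  have m: "0 < ?m" using r content_ball_pos[of r c] by (simp add: measure_completion)
  have le: "indicator (ball c' r) x \<le> inverse (j * ?m) * convolve J (indicator (ball c r)) x" for x
  proof (cases "x \<in> ball c' r")
    case True
    have "(LINT y|lborel. j * indicator (ball c r) y) \<le> convolve J (indicator (ball c r)) x"
      unfolding convolve_def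
    proof (rule integral_mono)
      show "integrable lborel (\<lambda>y. j * indicator (ball c r) y :: real)"
        using emeasure_lborel_ball_finite[of c r] by (intro integrable_mult_right integrable_real_indicator) auto
      show "integrable lborel (\<lambda>y. J (x - y) * indicator (ball c r) y)"
        by (intro integrable_convolve_test test)
      show "j * indicator (ball c r) y \<le> J (x - y) * indicator (ball c r) y" for y
      proof (cases "y \<in> ball c r")
        case y: True
        have "dist x y \<le> dist x c' + dist c' c + dist c y"
          by (meson dist_triangle dist_triangle_le order_trans add_mono order_refl)
        then have "norm (x - y) < 3 * r"
          using True y c' by (simp add: dist_norm[symmetric] dist_commute)
        then show ?thesis using J_lower y by simp
      qed simp
    qed
    then have "j * ?m \<le> convolve J (indicator (ball c r)) x"
      by simp
    then have "inverse (j * ?m) * (j * ?m) \<le> inverse (j * ?m) * convolve J (indicator (ball c r)) x"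
      using j m by (intro mult_left_mono) auto
    moreover have "inverse (j * ?m) * (j * ?m) = 1"
      using mult_pos_pos[OF j m] by (intro left_inverse) (metis less_irrefl)
    ultimately show ?thesis using True by (simp only: indicator_simps)
  next
    case False
    have "0 \<le> convolve J (indicator (ball c r)) x"
      unfolding convolve_def using J_nonneg by (intro Bochner_Integration.integral_nonneg) auto
    then show ?thesis using False j m by simp
  qed
  have conv: "bounded_test (convolve J (indicator (ball c r)))"
    by (rule convolve_test(2)[OF test, where B = 1]) (simp add: indicator_def)
  have "0 \<le> inverse (j * ?m)" using j m by simp
  then have "occupation_bounded (\<lambda>x. inverse (j * ?m) * convolve J (indicator (ball c r)) x)"
    by (intro occupation_cmult occupation_convolve[OF test _ occ]) auto
  then show ?thesis
    by (rule occupation_mono[OF _ test bounded_test_mult[OF bounded_test_const conv] le])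
qed

text \<open>Balls of radius \<open>r\<close> are moved along the segment from the origin to
  \<open>c\<close>. As \<open>r \<le> 2\<close>, the first one lies in the hole, where
  \<open>u t\<close> has no mass.\<close>

lemma occupation_ball:
  assumes r: "0 < r" "r \<le> 2" and j: "0 < j" and J_lower: "\<forall>x. norm x < 3 * r \<longrightarrow> j \<le> J x"
  shows "occupation_bounded (indicator (ball c r))"
proof -
  \<comment> \<open>\<open>N\<close> equal steps along the segment have length
    \<open>norm c / N\<close>, which this choice keeps below \<open>r\<close>.\<close>
  obtain N :: nat where N: "norm c / r < real N" using reals_Archimedean2 by blast
  have "0 \<le> norm c / r" using r by simp
  then have N0: "0 < N" using N by (cases N) auto
  have "occupation_bounded (indicator (ball ((real k / real N) *\<^sub>R c) r))" for k
  proof (induction k)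
    case 0
    have "pairing t (indicator (ball 0 r)) = 0" if "0 \<le> t" for t
      unfolding pairing_def using u_hole[OF that] r hole_contains
      by (intro integral_eq_zero_AE) (auto elim!: eventually_mono simp: indicator_def subset_iff)
    then have "integral {0..T} (\<lambda>t. pairing t (indicator (ball 0 r))) \<le> 0" for T
      by (subst integral_cong[where g = "\<lambda>_. 0"]) auto
    then show ?case by (auto simp: occupation_bounded_def)
  next
    case (Suc k)
    have "dist ((real k / real N) *\<^sub>R c) ((real (Suc k) / real N) *\<^sub>R c) = norm c / real N"
      using N0 by (simp add: dist_norm scaleR_left_diff_distrib[symmetric] diff_divide_distrib[symmetric])
    also have "\<dots> \<le> r" using N N0 r by (simp add: field_simps)
    finally show ?case by (rule occupation_ball_step[OF Suc.IH r(1) j J_lower])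
  qed
  from this[of N] show ?thesis using N0 by simp
qed

text \<open>By compactness finitely many balls of radius \<open>r\<close> cover the disc, and the
  sum of their indicators dominates that of the disc.\<close>

lemma occupation_cball:
  assumes r: "0 < r" "r \<le> 2" and j: "0 < j" and J_lower: "\<forall>x. norm x < 3 * r \<longrightarrow> j \<le> J x"
  shows "occupation_bounded (indicator (cball 0 \<rho>))"
proof -
  have "\<exists>k. finite k \<and> k \<subseteq> cball (0::plane) \<rho> \<and> cball 0 \<rho> \<subseteq> (\<Union>x\<in>k. ball x r)"
    by (rule seq_compact_imp_totally_bounded[rule_format])
      (use r in \<open>simp_all flip: compact_eq_seq_compact_metric\<close>)
  then obtain F where F: "finite F" "cball (0::plane) \<rho> \<subseteq> (\<Union>x\<in>F. ball x r)" by auto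
  have test: "bounded_test (indicator (ball a r) :: plane \<Rightarrow> real)" for a
    by (intro bounded_test_indicator) auto
  show ?thesis
  proof (rule occupation_mono)
    show "occupation_bounded (\<lambda>x. \<Sum>c\<in>F. indicator (ball c r) x)"
      by (rule occupation_sum[OF occupation_ball[OF assms] test])
    show "indicator (cball 0 \<rho>) x \<le> (\<Sum>c\<in>F. indicator (ball c r) x :: real)" for x
    proof (cases "x \<in> cball 0 \<rho>")
      case True
      then obtain c where "c \<in> F" "x \<in> ball c r" using F by blast
      then show ?thesis
        using True F(1) member_le_sum[of c F "\<lambda>c. indicator (ball c r) x :: real"] by simp
    qed (simp add: sum_nonneg)
  qed (auto intro: bounded_test_sum test bounded_test_indicator)
qed

lemma occupation_small_time:
  assumes occ: "occupation_bounded \<psi>" and \<psi>: "bounded_test \<psi>" and e: "0 < e"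
  obtains t where "0 \<le> t" "pairing t \<psi> < e"
proof -
  obtain C where C: "\<And>T. 0 \<le> T \<Longrightarrow> integral {0..T} (\<lambda>t. pairing t \<psi>) \<le> C"
    using occ by (auto simp: occupation_bounded_def)
  have "\<exists>t\<ge>0. pairing t \<psi> < e"
  proof (rule ccontr)
    assume "\<not> ?thesis"
    then have le: "e \<le> pairing t \<psi>" if "0 \<le> t" for t using that by force
    \<comment> \<open>If the pairing stayed at least \<open>e\<close>, its integral up to this
      \<open>T\<close> would be at least \<open>\<bar>C\<bar> + 1\<close>, contradicting the bound
      \<open>C\<close>.\<close>
    define T where "T = (\<bar>C\<bar> + 1) / e"
    have T: "0 \<le> T" using e by (simp add: T_def)
    have "integral {0..T} (\<lambda>t. e) \<le> integral {0..T} (\<lambda>t. pairing t \<psi>)"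
      using le by (intro integral_le pairing_integrable_on \<psi>) auto
    then have "T * e \<le> C" using C[OF T] T by simp
    then show False using e by (simp add: T_def)
  qed
  then show ?thesis using that by auto
qed

section \<open>Conservation and decay of the mass\<close>

text \<open>The conditions on \<open>\<phi>\<close> hold only almost everywhere. A representative
  that vanishes everywhere in the hole and satisfies its growth bound everywhere allows pointwise
  estimates inside convolutions.\<close>

lemma stationary_representative:
  assumes "log_stationary J H \<phi>"
  obtains g C where "g \<in> borel_measurable borel" and "AE x in lborel. g x = \<phi> x"
    and "\<And>x. x \<in> H \<Longrightarrow> g x = 0" and "0 \<le> C" and "\<And>x. \<bar>g x\<bar> \<le> logp x + C"
    and "AE x\<in>- H in lborel. \<bar>g x - ln (norm x)\<bar> \<le> C"
    and "AE x\<in>- H in lborel. convolve J g x = g x"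
proof -
  have \<phi>: "\<phi> \<in> borel_measurable borel" "AE x\<in>- H in lborel. nonlocal_op J \<phi> x = 0"
      "AE x\<in>H in lborel. \<phi> x = 0" "Linfty_on (- H) (\<lambda>x. \<phi> x - ln (norm x))"
    using assms by (auto simp: log_stationary_def)
  note [measurable] = \<phi>(1)
  obtain C' where C': "AE x\<in>- H in lborel. \<bar>\<phi> x - ln (norm x)\<bar> \<le> C'"
    using \<phi>(4) by (auto simp: Linfty_on_def)
  define C where "C = max 0 C'"
  have C: "AE x\<in>- H in lborel. \<bar>\<phi> x - ln (norm x)\<bar> \<le> C"
    using C' by eventually_elim (auto simp: C_def)
  \<comment> \<open>Setting the function to \<open>0\<close> off \<open>N\<close> changes
    \<open>\<phi>\<close> only on a null set: it already vanishes almost everywhere in the hole, and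
    outside the hole the logarithmic bound fails only on a null set.\<close>
  define N where "N = {x\<in>- H. \<bar>\<phi> x - ln (norm x)\<bar> \<le> C}"
  have [measurable]: "N \<in> sets borel" unfolding N_def by measurable
  define g where "g x = indicator N x * \<phi> x" for x
  have [measurable]: "g \<in> borel_measurable borel" unfolding g_def by measurable
  have eq: "AE x in lborel. g x = \<phi> x"
    using C \<phi>(3) by eventually_elim (auto simp: g_def N_def indicator_def)
  have conv: "convolve J g x = convolve J \<phi> x" for x
    unfolding convolve_def using eq by (intro integral_cong_AE) (auto elim!: eventually_mono)
  show ?thesis
  proof (rule that)
    show "g x = 0" if "x \<in> H" for x using that by (simp add: g_def N_def)
    show "0 \<le> C" by (simp add: C_def)
    show "\<bar>g x\<bar> \<le> logp x + C" for x
    proof (cases "x \<in> N")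
      case True
      then have "\<bar>\<phi> x - logp x\<bar> \<le> C" by (auto simp: N_def logp_outside)
      then show ?thesis using logp_nonneg[of x] True by (simp add: g_def)
    qed (use logp_nonneg[of x] in \<open>simp add: g_def C_def\<close>)
    show "AE x\<in>- H in lborel. \<bar>g x - ln (norm x)\<bar> \<le> C"
      using C eq by eventually_elim auto
    show "AE x\<in>- H in lborel. convolve J g x = g x"
      using \<phi>(2) eq by eventually_elim (simp add: conv nonlocal_op_def)
  qed (use eq in auto)
qed

section \<open>Cut-offs of the stationary solution and conservation of its pairing\<close>

text \<open>A cone with slope \<open>1 / n\<close>, small enough to beat the logarithmic growth of
  the stationary solution. For \<open>n = 0\<close> division by zero makes it the constant
  \<open>1\<close>; only large \<open>n\<close> matter.\<close>

definition cutoff :: "nat \<Rightarrow> plane \<Rightarrow> real" where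
  "cutoff n x = max 0 (1 - norm x / real n)"

lemma cutoff_measurable [measurable]: "cutoff n \<in> borel_measurable borel"
  unfolding cutoff_def by measurable

lemma cutoff_range: "0 \<le> cutoff n x" "cutoff n x \<le> 1"
  by (auto simp: cutoff_def)

lemma cutoff_zero: "real n \<le> norm x \<Longrightarrow> 0 < n \<Longrightarrow> cutoff n x = 0"
  by (simp add: cutoff_def field_simps)

lemma cutoff_lipschitz: "\<bar>cutoff n x - cutoff n y\<bar> \<le> norm (x - y) / real n"
proof -
  have "\<bar>norm x / real n - norm y / real n\<bar> \<le> norm (x - y) / real n"
    using norm_triangle_ineq3[of x y]
    by (simp add: diff_divide_distrib[symmetric] divide_right_mono)
  then show ?thesis by (simp add: cutoff_def max_def abs_if split: if_splits)
qed

lemma cutoff_tendsto: "(\<lambda>n. cutoff n x) \<longlonglongrightarrow> 1"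
proof -
  have "(\<lambda>n. max 0 (1 - norm x / real n)) \<longlonglongrightarrow> max 0 (1 - 0)"
    by (intro tendsto_intros lim_const_over_n)
  then show ?thesis by (simp add: cutoff_def)
qed

context
  fixes g :: "plane \<Rightarrow> real" and C :: real
  assumes g_measurable [measurable]: "g \<in> borel_measurable borel"
    and g_hole: "\<And>x. x \<in> H \<Longrightarrow> g x = 0"
    and C_nonneg: "0 \<le> C"
    and g_bound: "\<And>x. \<bar>g x\<bar> \<le> logp x + C"
    and g_log: "AE x\<in>- H in lborel. \<bar>g x - ln (norm x)\<bar> \<le> C"
    and g_stationary: "AE x\<in>- H in lborel. convolve J g x = g x"
begin

lemma pairing_stationary_integrable:
  assumes t: "0 \<le> t"
  shows "integrable lborel (\<lambda>x. u t x * g x)"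
proof -
  have [measurable]: "u t \<in> borel_measurable borel" using t by (rule u_measurable)
  have *: "integrable lborel (\<lambda>x. u t x * (logp x + C))"
    using log_moment[OF t] u_integrable[OF t] by (auto simp: distrib_left)
  show "integrable lborel (\<lambda>x. u t x * g x)"
  proof (rule Bochner_Integration.integrable_bound[OF *])
    show "AE x in lborel. norm (u t x * g x) \<le> norm (u t x * (logp x + C))"
      using g_bound by (auto simp: abs_mult intro!: mult_left_mono order_trans[OF g_bound])
  qed measurable
qed

text \<open>The product of \<open>ln n + ln (d + 3) + C\<close>, a bound for \<open>g\<close> up to
  radius \<open>n + d\<close>, and \<open>d / n\<close>, the largest change of the cut-off over one
  jump.\<close>

definition drift_error :: "nat \<Rightarrow> real" where
  "drift_error n = d * (ln (real n) / real n) + d * (ln (d + 3) + C) / real n"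

lemma drift_error_tendsto: "drift_error \<longlonglongrightarrow> 0"
proof -
  have "(\<lambda>n. d * (ln (real n) / real n) + d * (ln (d + 3) + C) / real n) \<longlonglongrightarrow> d * 0 + 0"
    by (intro tendsto_intros lim_ln_over_n lim_const_over_n)
  then show ?thesis by (simp add: drift_error_def[abs_def])
qed

lemma cutoff_test:
  assumes n: "2 \<le> n"
  shows "bounded_test (\<lambda>x. g x * cutoff n x)"
proof (rule bounded_testI)
  show "\<bar>g x * cutoff n x\<bar> \<le> ln (real n) + C" for x
  proof (cases "real n \<le> norm x")
    case True
    then show ?thesis using n C_nonneg by (simp add: cutoff_zero)
  next
    case False
    have "\<bar>g x * cutoff n x\<bar> \<le> \<bar>g x\<bar> * 1"
      unfolding abs_mult using cutoff_range[of n x] by (intro mult_left_mono) auto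
    also have "\<dots> \<le> logp x + C" using g_bound by simp
    also have "\<dots> \<le> ln (real n) + C" using False n by (simp add: logp_def)
    finally show ?thesis .
  qed
qed measurable

text \<open>Stationarity rewrites \<open>g x * cutoff n x\<close> as an average over jumps, so the
  drift is the commutator: the integral of
  \<open>J (x - y) * g y * (cutoff n y - cutoff n x)\<close>. Multiplication by the cut-off almost
  commutes with convolution because the cut-off varies slowly.\<close>

lemma cutoff_drift:
  assumes n: "2 \<le> n"
  shows "AE x\<in>- H in lborel. \<bar>killed (\<lambda>x. g x * cutoff n x) x - g x * cutoff n x\<bar> \<le> drift_error n"
  using g_stationary
proof eventually_elim
  case (elim x)
  show ?case
  proof
    assume "x \<in> - H"
    with elim have stat: "convolve J g x = g x" by simp
    have pos: "0 < real n" using n by simp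
    have int_g: "integrable lborel (\<lambda>y. J (x - y) * g y)"
    proof (rule Bochner_Integration.integrable_bound)
      show "integrable lborel (\<lambda>y. J (x - y) * (logp x + d + C))"
        using J_shift_integrable by simp
      have "norm (J (x - y) * g y) \<le> norm (J (x - y) * (logp x + d + C))" for y
      proof (cases "norm (x - y) < d")
        case True
        then have "\<bar>g y\<bar> \<le> \<bar>logp x + d + C\<bar>"
          using g_bound[of y] logp_lipschitz[of y x] by (simp add: norm_minus_commute)
        then show ?thesis by (simp add: abs_mult mult_left_mono)
      qed (simp add: J_range)
      then show "AE y in lborel. norm (J (x - y) * g y) \<le> norm (J (x - y) * (logp x + d + C))"
        by simp
    qed measurable
    have int_c: "integrable lborel (\<lambda>y. J (x - y) * (g y * cutoff n y))"
      by (intro integrable_convolve_test cutoff_test n)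
    \<comment> \<open>Since \<open>g\<close> vanishes everywhere in the hole, the restriction built
      into \<open>killed\<close> has no effect.\<close>
    have "killed (\<lambda>x. g x * cutoff n x) x = (LINT y|lborel. J (x - y) * (g y * cutoff n y))"
      unfolding killed_def convolve_def
      by (intro Bochner_Integration.integral_cong) (auto simp: indicator_def g_hole)
    moreover have "g x * cutoff n x = (LINT y|lborel. J (x - y) * g y * cutoff n x)"
      using stat by (simp add: convolve_def)
    ultimately have "killed (\<lambda>x. g x * cutoff n x) x - g x * cutoff n x
      = (LINT y|lborel. J (x - y) * (g y * cutoff n y) - J (x - y) * g y * cutoff n x)"
      using int_c int_g by simp
    also have "\<bar>\<dots>\<bar> \<le> (LINT y|lborel. \<bar>J (x - y) * (g y * cutoff n y) - J (x - y) * g y * cutoff n x\<bar>)"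
      by (rule integral_abs_bound)
    also have "\<dots> \<le> (LINT y|lborel. J (x - y) * drift_error n)"
    proof (rule integral_mono)
      show "integrable lborel (\<lambda>y. \<bar>J (x - y) * (g y * cutoff n y) - J (x - y) * g y * cutoff n x\<bar>)"
        using int_c int_g by auto
      show "integrable lborel (\<lambda>y. J (x - y) * drift_error n)"
        using J_shift_integrable by simp
      show "\<bar>J (x - y) * (g y * cutoff n y) - J (x - y) * g y * cutoff n x\<bar> \<le> J (x - y) * drift_error n" for y
      proof (cases "norm (x - y) < d")
        case True
        have error: "0 \<le> drift_error n"
          unfolding drift_error_def using n range_nonneg C_nonneg by (intro add_nonneg_nonneg mult_nonneg_nonneg divide_nonneg_nonneg) auto
        have "\<bar>g y\<bar> * \<bar>cutoff n y - cutoff n x\<bar> \<le> drift_error n"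
        proof (cases "norm y < real n + d")
          case y: True
          \<comment> \<open>The sum \<open>n + d\<close> is replaced by a product whose logarithm
            splits and which also exceeds the truncation level \<open>2\<close> of
            \<open>logp\<close>.\<close>
          have le: "norm y \<le> real n * (d + 3)"
          proof -
            have "1 * d \<le> real n * d" using n range_nonneg by (intro mult_right_mono) auto
            then show ?thesis using y pos unfolding distrib_left by linarith
          qed
          have "2 \<le> real n * (d + 3)"
            using mult_mono[of 2 "real n" 1 "d + 3"] n range_nonneg by simp
          then have "logp y \<le> ln (real n * (d + 3))"
            using le unfolding logp_def by (intro ln_mono) auto
          also have "\<dots> = ln (real n) + ln (d + 3)"
            using pos range_nonneg by (intro ln_mult_pos) auto
          finally have "\<bar>g y\<bar> \<le> ln (real n) + ln (d + 3) + C"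
            using g_bound[of y] by linarith
          moreover have "\<bar>cutoff n y - cutoff n x\<bar> \<le> d / real n"
            using cutoff_lipschitz[of n y x] True divide_right_mono[of "norm (x - y)" d "real n"]
            by (simp add: norm_minus_commute)
          ultimately have "\<bar>g y\<bar> * \<bar>cutoff n y - cutoff n x\<bar> \<le> (ln (real n) + ln (d + 3) + C) * (d / real n)"
            by (intro mult_mono) auto
          also have "\<dots> = drift_error n"
            by (simp add: drift_error_def algebra_simps add_divide_distrib)
          finally show ?thesis .
        next
          \<comment> \<open>Beyond radius \<open>n + d\<close>, a jump shorter than \<open>d\<close>
            stays beyond radius \<open>n\<close>, so both cut-off values are
            \<open>0\<close>.\<close>
          case False
          have "real n \<le> norm y" using False range_nonneg by simp
          moreover have "real n \<le> norm x"
            using False True norm_triangle_ineq2[of y x] by (simp add: norm_minus_commute)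
          ultimately show ?thesis using n error by (simp add: cutoff_zero)
        qed
        then have "J (x - y) * (\<bar>g y\<bar> * \<bar>cutoff n y - cutoff n x\<bar>) \<le> J (x - y) * drift_error n"
          using J_nonneg by (intro mult_left_mono)
        moreover have "J (x - y) * (g y * cutoff n y) - J (x - y) * g y * cutoff n x
            = J (x - y) * (g y * (cutoff n y - cutoff n x))"
          by (simp add: algebra_simps)
        ultimately show ?thesis using J_nonneg[of "x - y"] by (simp only: abs_mult abs_of_nonneg)
      qed (simp add: J_range)
    qed
    also have "\<dots> = drift_error n" using J_shift_integral by simp
    finally show "\<bar>killed (\<lambda>x. g x * cutoff n x) x - g x * cutoff n x\<bar> \<le> drift_error n" .
  qed
qed

text \<open>The one-sided drift estimate is applied to the cut-off function and to its
  negative.\<close>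

lemma cutoff_conservation:
  assumes n: "2 \<le> n" and t: "0 \<le> t"
  shows "\<bar>pairing t (\<lambda>x. g x * cutoff n x) - pairing 0 (\<lambda>x. g x * cutoff n x)\<bar> \<le> drift_error n * mass 0 * t"
proof -
  let ?\<psi> = "\<lambda>x. g x * cutoff n x"
  note test = cutoff_test[OF n]
  have error: "0 \<le> drift_error n"
    unfolding drift_error_def using n range_nonneg C_nonneg
    by (intro add_nonneg_nonneg mult_nonneg_nonneg divide_nonneg_nonneg) auto
  have neg: "bounded_test (\<lambda>x. -1 * ?\<psi> x)" using bounded_test_mult[OF bounded_test_const test] .
  have "killed (\<lambda>x. -1 * ?\<psi> x) x = - killed ?\<psi> x" for x
    by (simp add: killed_def convolve_def)
  then have "AE x\<in>- H in lborel. killed (\<lambda>x. -1 * ?\<psi> x) x - (-1 * ?\<psi> x) \<le> drift_error n"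
    using cutoff_drift[OF n] by (auto elim!: eventually_mono)
  then have "pairing t (\<lambda>x. -1 * ?\<psi> x) \<le> pairing 0 (\<lambda>x. -1 * ?\<psi> x) + drift_error n * mass 0 * t"
    by (intro pairing_drift neg error t)
  moreover have "AE x\<in>- H in lborel. killed ?\<psi> x - ?\<psi> x \<le> drift_error n"
    using cutoff_drift[OF n] by (auto elim!: eventually_mono)
  then have "pairing t ?\<psi> \<le> pairing 0 ?\<psi> + drift_error n * mass 0 * t"
    by (intro pairing_drift test error t)
  ultimately show ?thesis unfolding pairing_cmult by linarith
qed

lemma pairing_cutoff_tendsto:
  assumes t: "0 \<le> t"
  shows "(\<lambda>n. pairing t (\<lambda>x. g x * cutoff n x)) \<longlonglongrightarrow> pairing t g"
  unfolding pairing_def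
proof (rule integral_dominated_convergence)
  have [measurable]: "u t \<in> borel_measurable borel" using t by (rule u_measurable)
  show "(\<lambda>x. u t x * g x) \<in> borel_measurable lborel" by measurable
  show "(\<lambda>x. u t x * (g x * cutoff n x)) \<in> borel_measurable lborel" for n by measurable
  show "integrable lborel (\<lambda>x. \<bar>u t x * g x\<bar>)"
    using pairing_stationary_integrable[OF t] by simp
  show "AE x in lborel. (\<lambda>n. u t x * (g x * cutoff n x)) \<longlonglongrightarrow> u t x * g x"
  proof (rule AE_I2)
    fix x
    have "(\<lambda>n. u t x * (g x * cutoff n x)) \<longlonglongrightarrow> u t x * (g x * 1)"
      by (intro tendsto_intros cutoff_tendsto)
    then show "(\<lambda>n. u t x * (g x * cutoff n x)) \<longlonglongrightarrow> u t x * g x" by simp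
  qed
  show "AE x in lborel. norm (u t x * (g x * cutoff n x)) \<le> \<bar>u t x * g x\<bar>" for n
    using cutoff_range[of n] by (auto simp: abs_mult intro!: mult_left_mono mult_left_le)
qed

text \<open>For fixed \<open>t\<close> the error \<open>drift_error n * mass 0 * t\<close> tends to
  \<open>0\<close> as the cut-off is removed, and dominated convergence identifies the limits of
  both pairings.\<close>

lemma conservation:
  assumes t: "0 \<le> t"
  shows "pairing t g = pairing 0 g"
proof -
  have "(\<lambda>n. \<bar>pairing t (\<lambda>x. g x * cutoff n x) - pairing 0 (\<lambda>x. g x * cutoff n x)\<bar>) \<longlonglongrightarrow> \<bar>pairing t g - pairing 0 g\<bar>"
    using t by (intro tendsto_intros pairing_cutoff_tendsto) auto
  moreover have "(\<lambda>n. drift_error n * mass 0 * t) \<longlonglongrightarrow> 0 * mass 0 * t"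
    by (intro tendsto_intros drift_error_tendsto)
  ultimately have "\<bar>pairing t g - pairing 0 g\<bar> \<le> 0 * mass 0 * t"
    using cutoff_conservation[OF _ t] by (intro LIMSEQ_le) auto
  then show ?thesis by simp
qed

section \<open>Tightness, decay of the mass and the limit of the logarithmic moment\<close>

text \<open>Outside the hole \<open>g + C\<close> is nonnegative and at least
  \<open>ln (norm x)\<close>, hence at least \<open>ln \<rho>\<close> beyond radius
  \<open>\<rho>\<close>. Integrating against \<open>u t\<close> and using conservation gives a bound
  independent of \<open>t\<close>.\<close>

lemma mass_tail:
  assumes t: "0 \<le> t" and \<rho>: "2 \<le> \<rho>"
  shows "ln \<rho> * pairing t (indicator (- cball 0 \<rho>)) \<le> pairing 0 g + C * mass 0"
proof -
  have out: "bounded_test (indicator (- cball 0 \<rho>) :: plane \<Rightarrow> real)" by (intro bounded_test_indicator) auto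
  have "ln \<rho> * pairing t (indicator (- cball 0 \<rho>)) = (LINT x|lborel. u t x * (ln \<rho> * indicator (- cball 0 \<rho>) x))"
    by (simp add: pairing_cmult[symmetric]) (simp add: pairing_def)
  also have "\<dots> \<le> (LINT x|lborel. u t x * g x + C * u t x)"
  proof (rule integral_mono_AE)
    show "integrable lborel (\<lambda>x. u t x * (ln \<rho> * indicator (- cball 0 \<rho>) x))"
      using t by (intro pairing_integrable bounded_test_mult bounded_test_const out)
    show "integrable lborel (\<lambda>x. u t x * g x + C * u t x)"
      using pairing_stationary_integrable[OF t] u_integrable[OF t] by auto
    show "AE x in lborel. u t x * (ln \<rho> * indicator (- cball 0 \<rho>) x) \<le> u t x * g x + C * u t x"
      using u_nonneg[OF t] u_hole[OF t] g_log
    proof eventually_elim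
      case (elim x)
      show ?case
      proof (cases "x \<in> H")
        case False
        then have "x \<notin> ball 0 2" using hole_contains by blast
        then have "2 \<le> norm x" by simp
        then have "0 \<le> ln (norm x)" by simp
        moreover have "ln (norm x) \<le> g x + C" using elim(3) False by auto
        moreover have "ln \<rho> \<le> ln (norm x)" if "\<rho> < norm x"
          using that \<rho> by (intro ln_mono) auto
        ultimately have "ln \<rho> * indicator (- cball 0 \<rho>) x \<le> g x + C"
          by (auto simp: indicator_def)
        then have "u t x * (ln \<rho> * indicator (- cball 0 \<rho>) x) \<le> u t x * (g x + C)"
          using elim(1) by (intro mult_left_mono)
        then show ?thesis by (simp add: algebra_simps)
      qed (use elim in simp)
    qed
  qed
  also have "\<dots> = pairing t g + C * mass t"
    using pairing_stationary_integrable[OF t] u_integrable[OF t] by (simp add: pairing_def)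
  also have "\<dots> \<le> pairing 0 g + C * mass 0"
    using conservation[OF t] mass_antimono[OF _ t] C_nonneg by (simp add: mult_left_mono)
  finally show ?thesis .
qed

text \<open>A large radius makes the tail mass less than \<open>e / 2\<close> at all times. Finite
  occupation of the disc supplies one time at which the mass inside it is also less than
  \<open>e / 2\<close>, and monotonicity keeps the total small from then on.\<close>

lemma mass_tendsto_0:
  assumes J_lower: "0 < j" "0 < r" "r \<le> 2" "\<forall>x. norm x < 3 * r \<longrightarrow> j \<le> J x"
  shows "(mass \<longlongrightarrow> 0) at_top"
proof (rule tendstoI)
  fix e :: real assume e: "0 < e"
  define E where "E = pairing 0 g + C * mass 0"
  \<comment> \<open>Then \<open>ln \<rho>\<close> exceeds \<open>2 * \<bar>E\<bar> / e\<close>, so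
    the tail bound \<open>E / ln \<rho>\<close> is below \<open>e / 2\<close>; the summand
    \<open>1\<close> ensures \<open>\<rho> \<ge> 2\<close> and a positive denominator.\<close>
  define \<rho> where "\<rho> = exp (1 + 2 * \<bar>E\<bar> / e)"
  have "exp 1 \<le> \<rho>" using e by (simp add: \<rho>_def)
  then have \<rho>: "2 \<le> \<rho>" using exp_ge_add_one_self[of 1] by linarith
  have ln_\<rho>: "ln \<rho> = 1 + 2 * \<bar>E\<bar> / e" by (simp add: \<rho>_def)
  have tests: "bounded_test (indicator (cball 0 \<rho>) :: plane \<Rightarrow> real)"
      "bounded_test (indicator (- cball 0 \<rho>) :: plane \<Rightarrow> real)"
    by (auto intro!: bounded_test_indicator)
  obtain t0 where t0: "0 \<le> t0" "pairing t0 (indicator (cball 0 \<rho>)) < e / 2"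
    using occupation_small_time[OF occupation_cball[OF J_lower(2,3,1,4)] tests(1), of "e / 2"] e by auto
  have "(1 + 2 * \<bar>E\<bar> / e) * pairing t0 (indicator (- cball 0 \<rho>)) \<le> E"
    using mass_tail[OF t0(1) \<rho>] by (simp add: ln_\<rho> E_def)
  moreover have pos: "0 < 1 + 2 * \<bar>E\<bar> / e" using e by (intro add_pos_nonneg) auto
  ultimately have "pairing t0 (indicator (- cball 0 \<rho>)) \<le> E / (1 + 2 * \<bar>E\<bar> / e)"
    by (simp add: pos_le_divide_eq mult.commute)
  also have "\<dots> < e / 2"
  proof -
    have "e / 2 * (1 + 2 * \<bar>E\<bar> / e) = e / 2 + \<bar>E\<bar>" using e by (simp add: field_simps)
    then show ?thesis unfolding pos_divide_less_eq[OF pos] using e by linarith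
  qed
  finally have "pairing t0 (indicator (- cball 0 \<rho>)) < e / 2" .
  moreover have "mass t0 = pairing t0 (\<lambda>x. indicator (cball 0 \<rho>) x + indicator (- cball 0 \<rho>) x)"
    unfolding pairing_def by (intro Bochner_Integration.integral_cong) (auto simp: indicator_def)
  ultimately have small: "mass t0 < e" using t0 tests by (simp add: pairing_add)
  show "\<forall>\<^sub>F t in at_top. dist (mass t) 0 < e"
    using eventually_ge_at_top[of t0]
  proof eventually_elim
    case (elim t)
    then show ?case
      using mass_antimono[OF t0(1) elim] small mass_nonneg[of t] t0(1) by simp
  qed
qed

text \<open>Outside the hole \<open>logp\<close> and \<open>g\<close> differ by at most
  \<open>C\<close>, so the logarithmic moment stays within \<open>C * mass t\<close> of the
  conserved pairing.\<close>

lemma log_pairing_tendsto: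
  assumes J_lower: "0 < j" "0 < r" "r \<le> 2" "\<forall>x. norm x < 3 * r \<longrightarrow> j \<le> J x"
  shows "((\<lambda>t. LINT x|lborel. u t x * logp x) \<longlongrightarrow> pairing 0 g) at_top"
proof -
  have le: "\<bar>(LINT x|lborel. u t x * logp x) - pairing 0 g\<bar> \<le> C * mass t" if t: "0 \<le> t" for t
  proof -
    note int = log_moment[OF t] pairing_stationary_integrable[OF t]
    have "(LINT x|lborel. u t x * logp x) - pairing t g = (LINT x|lborel. u t x * logp x - u t x * g x)"
      using int by (simp add: pairing_def)
    also have "\<bar>\<dots>\<bar> \<le> (LINT x|lborel. \<bar>u t x * logp x - u t x * g x\<bar>)"
      by (rule integral_abs_bound)
    also have "\<dots> \<le> (LINT x|lborel. C * u t x)"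
    proof (rule integral_mono_AE)
      show "integrable lborel (\<lambda>x. \<bar>u t x * logp x - u t x * g x\<bar>)" using int by auto
      show "integrable lborel (\<lambda>x. C * u t x)" using u_integrable[OF t] by simp
      show "AE x in lborel. \<bar>u t x * logp x - u t x * g x\<bar> \<le> C * u t x"
        using u_nonneg[OF t] u_hole[OF t] g_log
      proof eventually_elim
        case (elim x)
        show ?case
        proof (cases "x \<in> H")
          case False
          then have "\<bar>logp x - g x\<bar> \<le> C" using elim(3) by (auto simp: logp_outside)
          then have "u t x * \<bar>logp x - g x\<bar> \<le> u t x * C" using elim(1) by (intro mult_left_mono)
          moreover have "\<bar>u t x * logp x - u t x * g x\<bar> = u t x * \<bar>logp x - g x\<bar>"
            using elim(1) by (simp flip: right_diff_distrib add: abs_mult)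
          ultimately show ?thesis by (simp add: mult.commute)
        qed (use elim in simp)
      qed
    qed
    also have "\<dots> = C * mass t" by (simp add: pairing_def)
    finally show ?thesis by (simp only: conservation[OF t])
  qed
  have "((\<lambda>t. (LINT x|lborel. u t x * logp x) - pairing 0 g) \<longlongrightarrow> 0) at_top"
  proof (rule Lim_null_comparison)
    show "\<forall>\<^sub>F t in at_top. norm ((LINT x|lborel. u t x * logp x) - pairing 0 g) \<le> C * mass t"
      using eventually_ge_at_top[of 0] by eventually_elim (simp add: le)
    show "((\<lambda>t. C * mass t) \<longlongrightarrow> 0) at_top"
      using tendsto_mult_left[OF mass_tendsto_0[OF J_lower], of C] by simp
  qed
  then show ?thesis by (simp add: LIM_zero_iff)
qed

end

end

section \<open>Verification of the walk assumptions and transfer to the given stationary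
  solution\<close>

lemma C2_imp_continuous: "C2 f \<Longrightarrow> continuous_on UNIV f"
  unfolding C2_def by (meson continuous_at_imp_continuous_on has_derivative_continuous)

theorem corollary3p2:
  fixes H :: "plane set" and J u0 \<phi> :: "plane \<Rightarrow> real"
    and u :: "real \<Rightarrow> plane \<Rightarrow> real" and R d :: real
  assumes "H \<noteq> {}" and "bounded H" and "open H"
    and "2 < R" and "ball 0 2 \<subseteq> H" and "H \<subseteq> ball 0 R"
    and "C2 J" and "compactly_supported J" and "radially_symmetric J"
    and "0 < d" and "\<And>x. norm x < d \<Longrightarrow> 0 < J x" and "\<And>x. d \<le> norm x \<Longrightarrow> J x = 0"
    and "(LINT x|lborel. J x) = 1"
    and "AE x in lborel. 0 \<le> u0 x" and "AE x\<in>H in lborel. u0 x = 0"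
    and "Linfty_on UNIV u0" and "integrable lborel (\<lambda>x. u0 x * ln (norm x))"
    and "exterior_solution J H u0 u"
    and "log_stationary J H \<phi>"
  shows "(\<forall>t\<ge>0. integrable lborel (\<lambda>x. u t x * ln (norm x))) \<and>
         integrable lborel (\<lambda>x. u0 x * \<phi> x) \<and>
         ((\<lambda>t. LINT x|lborel. u t x * ln (norm x)) \<longlongrightarrow> (LINT x|lborel. u0 x * \<phi> x)) at_top"
proof -
  have cont: "continuous_on UNIV J" using \<open>C2 J\<close> by (rule C2_imp_continuous)
  have J_borel [measurable]: "J \<in> borel_measurable borel"
    using cont by (rule borel_measurable_continuous_onI)
  have sol: "continuous_into_L1 u" "AE x in lborel. u 0 x = u0 x"
      "\<And>t. 0 < t \<Longrightarrow> AE x\<in>H in lborel. u t x = 0"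
      "\<And>t. 0 < t \<Longrightarrow> ((\<lambda>s. LINT x:(- H)|lborel. \<bar>(u s x - u t x) / (s - t) - nonlocal_op J (u t) x\<bar>) \<longlongrightarrow> 0) (at t)"
    using \<open>exterior_solution J H u0 u\<close> by (auto simp: exterior_solution_def)
  have u_int: "integrable lborel (u t)" if "0 \<le> t" for t
    using sol(1) that by (auto simp: continuous_into_L1_def)
  have [measurable]: "u 0 \<in> borel_measurable borel" using u_int[of 0] by auto
  have [measurable]: "u0 \<in> borel_measurable borel"
    using \<open>Linfty_on UNIV u0\<close> by (simp add: Linfty_on_def set_borel_measurable_def)
  have [measurable]: "\<phi> \<in> borel_measurable borel"
    using \<open>log_stationary J H \<phi>\<close> by (simp add: log_stationary_def)
  interpret log_exterior_walk J H u d
  proof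
    show "0 \<le> J x" for x using assms(11,12)[of x] by (cases "norm x < d") auto
    show "J (- x) = J x" for x
      using \<open>radially_symmetric J\<close> unfolding radially_symmetric_def by (metis norm_minus_cancel)
    show "((\<lambda>s. LINT x|lborel. \<bar>u s x - u t x\<bar>) \<longlongrightarrow> 0) (at t within {0..})" if "0 \<le> t" for t
      using sol(1) that by (auto simp: continuous_into_L1_def)
    \<comment> \<open>The equation prescribes zero values in the hole only for positive times; at
      time \<open>0\<close> they come from the initial datum.\<close>
    show "AE x\<in>H in lborel. u t x = 0" if "0 \<le> t" for t
    proof (cases "t = 0")
      case True
      then show ?thesis using sol(2) assms(15) by (auto elim: AE_mp)
    qed (use sol(3) that in simp)
    show "AE x in lborel. 0 \<le> u 0 x" using sol(2) assms(14) by eventually_elim simp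
    have "integrable lborel (\<lambda>x. u 0 x * ln (norm x)) \<longleftrightarrow> integrable lborel (\<lambda>x. u0 x * ln (norm x))"
      using sol(2) by (intro integrable_cong_AE) (auto elim!: eventually_mono)
    then show "integrable lborel (\<lambda>x. u 0 x * ln (norm x))" using assms(17) by simp
  qed (use assms sol(4) u_int in auto)
  obtain g C where g: "g \<in> borel_measurable borel" "AE x in lborel. g x = \<phi> x"
      "\<And>x. x \<in> H \<Longrightarrow> g x = 0" "0 \<le> C" "\<And>x. \<bar>g x\<bar> \<le> logp x + C"
      "AE x\<in>- H in lborel. \<bar>g x - ln (norm x)\<bar> \<le> C"
      "AE x\<in>- H in lborel. convolve J g x = g x"
    using stationary_representative[OF \<open>log_stationary J H \<phi>\<close>] by blast
  note [measurable] = g(1)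
  \<comment> \<open>A minimum of \<open>J\<close> over a closed disc strictly inside its positivity
    region is a positive lower bound there.\<close>
  obtain x0 where x0: "x0 \<in> cball 0 (d / 2)" "\<forall>x\<in>cball 0 (d / 2). J x0 \<le> J x"
    using continuous_attains_inf[of "cball 0 (d / 2)" J] continuous_on_subset[OF cont] \<open>0 < d\<close>
    by auto
  \<comment> \<open>With \<open>r = min 2 (d / 6)\<close> the radius \<open>3 * r\<close> is at most
    \<open>d / 2\<close>, where the lower bound \<open>J x0\<close> holds, and
    \<open>r \<le> 2\<close> keeps the first ball of the chain in the hole.\<close>
  have J_lower: "0 < J x0" "0 < min 2 (d / 6)" "min 2 (d / 6) \<le> 2" "\<forall>x. norm x < 3 * min 2 (d / 6) \<longrightarrow> J x0 \<le> J x"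
    using x0 assms(11)[of x0] \<open>0 < d\<close> by auto
  have log_int: "integrable lborel (\<lambda>x. u t x * ln (norm x)) \<longleftrightarrow> integrable lborel (\<lambda>x. u t x * logp x)"
    and log_eq: "(LINT x|lborel. u t x * ln (norm x)) = (LINT x|lborel. u t x * logp x)" if "0 \<le> t" for t
  proof -
    have [measurable]: "u t \<in> borel_measurable borel" using that by (rule u_measurable)
    show "integrable lborel (\<lambda>x. u t x * ln (norm x)) \<longleftrightarrow> integrable lborel (\<lambda>x. u t x * logp x)"
      using pairing_log_AE[OF that] by (intro integrable_cong_AE) auto
    show "(LINT x|lborel. u t x * ln (norm x)) = (LINT x|lborel. u t x * logp x)"
      using pairing_log_AE[OF that] by (intro integral_cong_AE) auto
  qed
  have start: "AE x in lborel. u0 x * \<phi> x = u 0 x * g x"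
    using sol(2) g(2) by eventually_elim simp
  have "integrable lborel (\<lambda>x. u0 x * \<phi> x)"
    using integrable_cong_AE[THEN iffD2, OF _ _ start] pairing_stationary_integrable[OF g(1,3-7)]
    by simp
  moreover have "(LINT x|lborel. u0 x * \<phi> x) = pairing 0 g"
    unfolding pairing_def by (intro integral_cong_AE start) auto
  moreover have "((\<lambda>t. LINT x|lborel. u t x * ln (norm x)) \<longlongrightarrow> pairing 0 g) at_top"
    using log_pairing_tendsto[OF g(1,3-7) J_lower]
  proof (rule Lim_transform_eventually)
    show "\<forall>\<^sub>F t in at_top. (LINT x|lborel. u t x * logp x) = (LINT x|lborel. u t x * ln (norm x))"
      using eventually_ge_at_top[of 0] by eventually_elim (simp add: log_eq)
  qed
  ultimately show ?thesis using log_int log_moment by simp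
qed

end
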